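(* Let $\mu_1,\mu_2,\nu$ be real numbers, and let $f_1=h_1+\overline{g_1}$ be the harmonic mapping given by $$h_1(z)=\frac12\left(\frac{z}{1-z}+\frac{z}{(1-z)^2}\right),\qquad g_1(z)=\frac{e^{2i\mu_1}}{2}\left(\frac{z}{1-z}-\frac{z}{(1-z)^2}\right).$$ Let $f_2=h_2+\overline{g_2}$ be a locally univalent and sense-preserving harmonic mapping in $\mathbb{D}$ such that $$h_2(z)+e^{-2i\mu_2}g_2(z)=\int_0^z \frac{d\xi}{1-2\xi e^{i(\mu_1+\mu_2)}\cos\nu+\xi^2e^{2i(\mu_1+\mu_2)}},\quad z\in\mathbb{D},$$ and let $\omega(z)=az^n$ (with $a\in\mathbb{C}$, $|a|\le1$, $n\in\mathbb{N}$) be the analytic dilatation of $f_2$. Then the convolution $f_1*f_2$ is univalent and convex in the direction of $-(\mu_1+\mu_2)$ if either (1) $n=1,2$ and $|a|\leq 1$, or (2) $n\geq3$ and $|a|\leq n-1-\sqrt{n^2-2n}$.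
   Context: $\mathbb{D}=\{z\in\mathbb{C}:|z|<1\}$ and $\mathbb{N}=\{1,2,\dots\}$. Every complex-valued harmonic function on $\mathbb{D}$ is written $f=h+\overline{g}$ with $h,g$ analytic in $\mathbb{D}$, and is assumed normalized: $h(0)=h'(0)-1=g(0)=0$. Such $f$ is locally univalent and sense-preserving iff $|g'|<|h'|$ on $\mathbb{D}$; its analytic dilatation is $\omega=g'/h'$. For analytic $\phi_1(z)=\sum_{n\ge0} a_nz^n$, $\phi_2(z)=\sum_{n\ge0} b_nz^n$ the convolution is $(\phi_1*\phi_2)(z)=\sum_{n\ge0} a_nb_nz^n$. For harmonic $f_1=h_1+\overline{g_1}$, $f_2=h_2+\overline{g_2}$, $f_1*f_2:=h_1*h_2+\overline{g_1*g_2}$. For real $\gamma$, a domain is convex in the direction of $\gamma$ if every line parallel to the line joining the origin to $e^{i\gamma}$ has connected (possibly empty) intersection with it. A function on $\mathbb{D}$ is convex in the direction of $\gamma$ if it maps $\mathbb{D}$ onto a domain convex in the direction of $\gamma$. *)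

theory Defs
  imports "HOL-Complex_Analysis.Complex_Analysis"
begin

abbreviation unit_disc :: "complex set" ("\<DD>") where
  "\<DD> \<equiv> ball 0 1"

text \<open>A harmonic function on the disc is handled through its analytic part \<open>h\<close> and co-analytic
  part \<open>g\<close>; with \<open>g 0 = 0\<close> this pair is uniquely determined by the function \<open>h + cnj g\<close>.\<close>

definition harmonic_fun :: "(complex \<Rightarrow> complex) \<Rightarrow> (complex \<Rightarrow> complex) \<Rightarrow> complex \<Rightarrow> complex" where
  "harmonic_fun h g = (\<lambda>z. h z + cnj (g z))"

definition normalized_harmonic :: "(complex \<Rightarrow> complex) \<Rightarrow> (complex \<Rightarrow> complex) \<Rightarrow> bool" where
  "normalized_harmonic h g \<longleftrightarrow>
     h holomorphic_on \<DD> \<and> g holomorphic_on \<DD> \<and> h 0 = 0 \<and> deriv h 0 = 1 \<and> g 0 = 0"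

definition locally_univalent_on :: "(complex \<Rightarrow> complex) \<Rightarrow> complex set \<Rightarrow> bool" where
  "locally_univalent_on f S \<longleftrightarrow> (\<forall>z\<in>S. \<exists>U. open U \<and> z \<in> U \<and> U \<subseteq> S \<and> inj_on f U)"

text \<open>The determinant of the real derivative of \<open>f\<close>, viewed as a map of the plane: its columns are
  the partial derivatives in the directions \<open>1\<close> and \<open>\<i>\<close>.\<close>

definition jacobian :: "(complex \<Rightarrow> complex) \<Rightarrow> complex \<Rightarrow> real" where
  "jacobian f z =
     (let D = frechet_derivative f (at z) in Re (D 1) * Im (D \<i>) - Im (D 1) * Re (D \<i>))"

definition sense_preserving_on :: "(complex \<Rightarrow> complex) \<Rightarrow> complex set \<Rightarrow> bool" where
  "sense_preserving_on f S \<longleftrightarrow> (\<forall>z\<in>S. f differentiable at z \<and> jacobian f z > 0)"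

definition dilatation :: "(complex \<Rightarrow> complex) \<Rightarrow> (complex \<Rightarrow> complex) \<Rightarrow> complex \<Rightarrow> complex" where
  "dilatation h g = (\<lambda>z. deriv g z / deriv h z)"

text \<open>The Hadamard product of the Taylor series at the origin.\<close>

definition convolution :: "(complex \<Rightarrow> complex) \<Rightarrow> (complex \<Rightarrow> complex) \<Rightarrow> complex \<Rightarrow> complex" where
  "convolution \<phi>1 \<phi>2 =
     (\<lambda>z. \<Sum>n. fps_nth (fps_expansion \<phi>1 0) n * fps_nth (fps_expansion \<phi>2 0) n * z ^ n)"

definition harmonic_convolution ::
  "(complex \<Rightarrow> complex) \<Rightarrow> (complex \<Rightarrow> complex) \<Rightarrow> (complex \<Rightarrow> complex) \<Rightarrow> (complex \<Rightarrow> complex)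
     \<Rightarrow> complex \<Rightarrow> complex" where
  "harmonic_convolution h1 g1 h2 g2 = harmonic_fun (convolution h1 h2) (convolution g1 g2)"

definition convex_in_direction :: "real \<Rightarrow> complex set \<Rightarrow> bool" where
  "convex_in_direction \<gamma> S \<longleftrightarrow> (\<forall>p. connected (S \<inter> range (\<lambda>t::real. p + of_real t * cis \<gamma>)))"

text \<open>The image is required to be a domain, i.e.\ open and connected (it is never empty).\<close>

definition maps_disc_convex_in_direction :: "real \<Rightarrow> (complex \<Rightarrow> complex) \<Rightarrow> bool" where
  "maps_disc_convex_in_direction \<gamma> f \<longleftrightarrow>
     open (f ` \<DD>) \<and> connected (f ` \<DD>) \<and> convex_in_direction \<gamma> (f ` \<DD>)"

end

theory Submission imports Defs begin

text \<open>Put \<open>\<alpha> = \<mu>1 + \<mu>2\<close>, \<open>u = cis \<alpha> * z\<close> and \<open>P = 1 / (1 - 2 u cos \<nu> + u\<^sup>2)\<close>. Convolving with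
  \<open>f\<^sub>1\<close> is a first-order differential operator: the result is \<open>f = H + cnj G\<close> with \<open>H = (h\<^sub>2 + z h\<^sub>2') / 2\<close> and
  \<open>G = exp (2 \<i> \<mu>1) (g\<^sub>2 - z g\<^sub>2') / 2\<close> (\<open>convolution_eqI\<close>). The shear condition gives
  \<open>h\<^sub>2' = P / (1 + w)\<close> with \<open>w = exp (-2 \<i> \<mu>2) a z^n\<close>, so all derivatives of \<open>H\<close> and \<open>G\<close> are explicit in
  terms of \<open>P\<close>, \<open>w\<close> and \<open>q = (1 - u\<^sup>2) P\<close>. The function \<open>q\<close> enters through \<open>z P' = (q - 1) P\<close> and has
  positive real part on the disc.

  Two facts about \<open>f\<close> are needed. First, \<open>norm G' < norm H'\<close>. After removal of common factors this is an
  inequality between the complex numbers \<open>q\<close> and \<open>w\<close>; completing the square in \<open>Im q\<close> reduces it to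
  \<open>2 (n - 1) r \<le> 1 + r\<^sup>2\<close> for \<open>r = norm w\<close>. For \<open>n \<le> 2\<close> this always holds, and for \<open>n \<ge> 3\<close> the admissible bound
  on \<open>norm a\<close> is the smaller root of the corresponding quadratic equation (\<open>dilatation_bound\<close>,
  \<open>root_bound\<close>). Second,
  \<open>(H' - exp (-2 \<i> \<alpha>) G') / P = (q + (1 - w) / (1 + w)) / 2\<close>, whose real part is at least \<open>Re q / 2\<close>.

  It remains to deduce univalence and directional convexity from these two facts
  (\<open>royster_ziegler_harmonic\<close>). A primitive of \<open>P\<close> maps the disc conformally onto a vertical strip or a
  half-plane with vertical boundary; call the new variable \<open>\<zeta>\<close> (\<open>disc_model\<close>). In this variable
  \<open>F = cis \<alpha> * f\<close> has an analytic part \<open>h\<close> and a co-analytic part \<open>g\<close> for which \<open>Re (h' - g')\<close> is bounded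
  below by a positive number on each vertical line. As \<open>Im F = Im (h - g)\<close>, every level of \<open>Im F\<close> is
  attained exactly once on each vertical line, so the level curves are graphs over the whole range of
  \<open>Re \<zeta>\<close>. Along such a graph \<open>Re F\<close> is strictly increasing because the Jacobian of \<open>F\<close> is positive. Hence \<open>F\<close>
  is injective, and its image meets every horizontal line in a continuous image of an interval (\<open>strip_shear\<close>). Rotating
  back by \<open>cis (- \<alpha>)\<close> gives the claim for \<open>f\<close>.\<close>

section \<open>Shearing on a vertical strip\<close>

text \<open>Mere positivity of \<open>Re (h' - g')\<close> would make \<open>Im F\<close>, for \<open>F = harmonic_fun h g\<close>, increasing on vertical lines
  without making it unbounded there, and then a level of \<open>Im F\<close> could be missed by some of the lines. A
  lower bound \<open>\<delta>\<close> that is constant on each line excludes this: \<open>T \<zeta> = Re \<zeta> + \<i> Im (F \<zeta>)\<close> is a bijection of the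
  strip onto itself. Its inverse straightens the level curves, and the derivative of \<open>Re F\<close> along them is the Jacobian
  of \<open>F\<close> divided by \<open>Re (h' - g')\<close>.\<close>

lemma strip_shear:
  fixes h g h' g' :: "complex \<Rightarrow> complex" and I :: "real set" and \<delta> :: "real \<Rightarrow> real"
  defines "\<Omega> \<equiv> Re -` I"
  assumes I: "open I" "connected I"
    and h: "\<And>\<zeta>. \<zeta> \<in> \<Omega> \<Longrightarrow> (h has_field_derivative h' \<zeta>) (at \<zeta>)"
    and g: "\<And>\<zeta>. \<zeta> \<in> \<Omega> \<Longrightarrow> (g has_field_derivative g' \<zeta>) (at \<zeta>)"
    and dil: "\<And>\<zeta>. \<zeta> \<in> \<Omega> \<Longrightarrow> norm (g' \<zeta>) < norm (h' \<zeta>)"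
    and \<delta>: "\<And>x. x \<in> I \<Longrightarrow> \<delta> x > 0"
    and pos: "\<And>\<zeta>. \<zeta> \<in> \<Omega> \<Longrightarrow> Re (h' \<zeta> - g' \<zeta>) \<ge> \<delta> (Re \<zeta>)"
  shows "inj_on (harmonic_fun h g) \<Omega>"
    and "open (harmonic_fun h g ` \<Omega>)"
    and "connected (harmonic_fun h g ` \<Omega>)"
    and "connected (harmonic_fun h g ` \<Omega> \<inter> {w. Im w = c})"
proof -
  define F where "F = harmonic_fun h g"
  define V where "V = (\<lambda>\<zeta>. Im (h \<zeta> - g \<zeta>))"
  define w where "w = (\<lambda>\<zeta>. h' \<zeta> - g' \<zeta>)"
  define T where "T = (\<lambda>\<zeta>. Complex (Re \<zeta>) (V \<zeta>))"
  have in_\<Omega>: "\<zeta> \<in> \<Omega> \<longleftrightarrow> Re \<zeta> \<in> I" for \<zeta> by (simp add: \<Omega>_def)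
  have open_\<Omega>: "open \<Omega>"
    unfolding \<Omega>_def using I(1) by (intro open_vimage continuous_intros)
  have conv_\<Omega>: "convex \<Omega>"
    unfolding \<Omega>_def using I(2)
    by (intro convex_linear_vimage bounded_linear.linear bounded_linear_Re)
      (simp add: is_interval_convex_1[symmetric] is_interval_connected_1)
  have ImF: "Im (F \<zeta>) = V \<zeta>" for \<zeta> by (simp add: F_def V_def harmonic_fun_def)
  have w_pos: "Re (w \<zeta>) > 0" if "\<zeta> \<in> \<Omega>" for \<zeta>
    using pos[OF that] \<delta>[of "Re \<zeta>"] that by (simp add: w_def in_\<Omega>)
  have dV: "((\<lambda>\<zeta>. h \<zeta> - g \<zeta>) has_derivative (\<lambda>v. w \<zeta> * v)) (at \<zeta>)" if "\<zeta> \<in> \<Omega>" for \<zeta>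
    using DERIV_diff[OF h[OF that] g[OF that]] by (simp add: w_def has_field_derivative_def)
  have dT: "(T has_derivative (\<lambda>v. Complex (Re v) (Im (w \<zeta> * v)))) (at \<zeta>)" if "\<zeta> \<in> \<Omega>" for \<zeta>
  proof -
    have "((\<lambda>\<zeta>. of_real (Re \<zeta>) + \<i> * of_real (V \<zeta>)) has_derivative
       (\<lambda>v. of_real (Re v) + \<i> * of_real (Im (w \<zeta> * v)))) (at \<zeta>)"
      unfolding V_def
      by (intro derivative_intros bounded_linear.has_derivative[OF bounded_linear_Re]
          bounded_linear.has_derivative[OF bounded_linear_Im] dV that)
    then show ?thesis by (simp add: T_def Complex_eq)
  qed
  have V_line: "((\<lambda>y. V (Complex x y)) has_real_derivative Re (w (Complex x y))) (at y)"
    if "x \<in> I" for x y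
  proof -
    have "((\<lambda>y. of_real x + \<i> * of_real y) has_derivative (\<lambda>t. \<i> * of_real t)) (at y)"
      by (auto intro!: derivative_eq_intros)
    from has_derivative_compose[OF this, of "\<lambda>\<zeta>. h \<zeta> - g \<zeta>"] dV[of "Complex x y"] that
    have "((\<lambda>y. h (Complex x y) - g (Complex x y)) has_derivative
        (\<lambda>t. w (Complex x y) * (\<i> * of_real t))) (at y)"
      by (simp add: Complex_eq in_\<Omega>)
    from bounded_linear.has_derivative[OF bounded_linear_Im this]
    show ?thesis unfolding V_def has_field_derivative_def
      by (rule back_subst[of "\<lambda>f. (_ has_derivative f) _"]) (simp add: fun_eq_iff)
  qed
  \<comment> \<open>Linear growth in both vertical directions: it gives injectivity of \<open>T\<close> and, by the
      intermediate value theorem, surjectivity.\<close>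
  have V_growth: "V (Complex x y2) - V (Complex x y1) \<ge> \<delta> x * (y2 - y1)"
    if "x \<in> I" "y1 \<le> y2" for x y1 y2
  proof -
    have "V (Complex x y1) - \<delta> x * y1 \<le> V (Complex x y2) - \<delta> x * y2"
    proof (rule DERIV_nonneg_imp_nondecreasing[OF that(2)])
      fix y
      have "((\<lambda>y. V (Complex x y) - \<delta> x * y) has_real_derivative Re (w (Complex x y)) - \<delta> x) (at y)"
        using V_line[OF that(1)] by (auto intro!: derivative_eq_intros)
      moreover have "Re (w (Complex x y)) - \<delta> x \<ge> 0"
        using pos[of "Complex x y"] that by (simp add: w_def in_\<Omega>)
      ultimately show "\<exists>d. ((\<lambda>y. V (Complex x y) - \<delta> x * y) has_real_derivative d) (at y) \<and> d \<ge> 0"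
        by blast
    qed
    then show ?thesis by (simp add: algebra_simps)
  qed
  have inj_T: "inj_on T \<Omega>"
  proof (rule inj_onI)
    fix \<zeta>1 \<zeta>2 assume A: "\<zeta>1 \<in> \<Omega>" "\<zeta>2 \<in> \<Omega>" "T \<zeta>1 = T \<zeta>2"
    have mono: "\<not> Im \<zeta> < Im \<zeta>'" if "\<zeta> \<in> \<Omega>" "Re \<zeta> = Re \<zeta>'" "V \<zeta> = V \<zeta>'" for \<zeta> \<zeta>'
    proof
      assume "Im \<zeta> < Im \<zeta>'"
      moreover have "\<delta> (Re \<zeta>) > 0" using \<delta> that by (simp add: in_\<Omega>)
      moreover have "Complex (Re \<zeta>) (Im \<zeta>') = \<zeta>'" "Complex (Re \<zeta>) (Im \<zeta>) = \<zeta>"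
        using that by (metis complex_surj)+
      ultimately show False
        using V_growth[of "Re \<zeta>" "Im \<zeta>" "Im \<zeta>'"] that
        by (simp add: in_\<Omega> mult_le_0_iff)
    qed
    show "\<zeta>1 = \<zeta>2"
      using mono[of \<zeta>1 \<zeta>2] mono[of \<zeta>2 \<zeta>1] A by (simp add: T_def complex_eq_iff)
  qed
  have surj_T: "T ` \<Omega> = \<Omega>"
  proof
    show "T ` \<Omega> \<subseteq> \<Omega>" by (auto simp: T_def in_\<Omega>)
    show "\<Omega> \<subseteq> T ` \<Omega>"
    proof
      fix p assume "p \<in> \<Omega>"
      then have x: "Re p \<in> I" by (simp add: in_\<Omega>)
      define y0 where "y0 = (\<bar>Im p\<bar> + \<bar>V (Complex (Re p) 0)\<bar>) / \<delta> (Re p)"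
      have y0: "\<delta> (Re p) * y0 = \<bar>Im p\<bar> + \<bar>V (Complex (Re p) 0)\<bar>" "y0 \<ge> 0"
        using \<delta>[OF x] by (auto simp: y0_def)
      have "\<exists>y\<ge>-y0. y \<le> y0 \<and> V (Complex (Re p) y) = Im p"
      proof (rule IVT)
        show "V (Complex (Re p) (- y0)) \<le> Im p" "Im p \<le> V (Complex (Re p) y0)" "-y0 \<le> y0"
          using V_growth[OF x, of "-y0" 0] V_growth[OF x, of 0 y0] y0 by auto
        show "\<forall>y. - y0 \<le> y \<and> y \<le> y0 \<longrightarrow> isCont (\<lambda>y. V (Complex (Re p) y)) y"
          using V_line[OF x] DERIV_isCont by blast
      qed
      then obtain y where "V (Complex (Re p) y) = Im p" by blast
      then have "p = T (Complex (Re p) y)" by (simp add: T_def)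
      then show "p \<in> T ` \<Omega>" using x by (auto simp: in_\<Omega>)
    qed
  qed
  define S where "S = the_inv_into \<Omega> T"
  have ST: "S (T \<zeta>) = \<zeta>" if "\<zeta> \<in> \<Omega>" for \<zeta>
    using that inj_T by (simp add: S_def the_inv_into_f_f)
  have TS: "T (S p) = p" and S_in: "S p \<in> \<Omega>" if "p \<in> \<Omega>" for p
    using that inj_T surj_T by (auto simp: S_def f_the_inv_into_f the_inv_into_into)
  have dS: "(S has_derivative
      (\<lambda>v. Complex (Re v) ((Im v - Im (w (S p)) * Re v) / Re (w (S p))))) (at p)"
    if "p \<in> \<Omega>" for p
  proof -
    let ?T' = "\<lambda>v. Complex (Re v) (Im (w (S p) * v))"
    let ?S' = "\<lambda>v. Complex (Re v) ((Im v - Im (w (S p)) * Re v) / Re (w (S p)))"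
    have "(S has_derivative ?S') (at (T (S p)))"
    proof (rule has_derivative_inverse_strong[OF open_\<Omega> S_in[OF that] _ ST dT[OF S_in[OF that]]])
      show "continuous_on \<Omega> T"
        using dT by (meson continuous_at_imp_continuous_on has_derivative_continuous)
      show "?T' \<circ> ?S' = id"
        using w_pos[OF S_in[OF that]] by (auto simp: fun_eq_iff complex_eq_iff field_simps)
    qed
    then show ?thesis by (simp add: TS that)
  qed
  \<comment> \<open>The curve \<open>x \<mapsto> S (x + \<i> c)\<close> parametrizes the level curve \<open>Im F = c\<close>; \<open>R c\<close> is \<open>Re F\<close> along it.\<close>
  define R where "R = (\<lambda>c x. Re (F (S (Complex x c))))"
  have dR: "(R c has_real_derivative
      ((norm (h' \<zeta>))\<^sup>2 - (norm (g' \<zeta>))\<^sup>2) / Re (w \<zeta>)) (at x)"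
    if "x \<in> I" "\<zeta> = S (Complex x c)" for x c \<zeta>
  proof -
    \<comment> \<open>The tangent vector of the level curve: \<open>w \<zeta> * \<tau>\<close> is real because \<open>Im F\<close> is constant on the curve.\<close>
    let ?\<tau> = "Complex 1 (- Im (w \<zeta>) / Re (w \<zeta>))"
    have p: "Complex x c \<in> \<Omega>" using that by (simp add: in_\<Omega>)
    then have \<zeta>: "\<zeta> \<in> \<Omega>" using S_in that by simp
    have line: "((\<lambda>x. Complex x c) has_derivative of_real) (at x)"
      unfolding Complex_eq by (auto intro!: derivative_eq_intros)
    have "((\<lambda>x. S (Complex x c)) has_derivative (\<lambda>t. Complex (Re (of_real t))
        ((Im (of_real t) - Im (w \<zeta>) * Re (of_real t)) / Re (w \<zeta>)))) (at x)"
      using has_derivative_compose[OF line dS[OF p]] by (simp only: that(2))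
    moreover have "(\<lambda>t. Complex (Re (of_real t))
        ((Im (of_real t) - Im (w \<zeta>) * Re (of_real t)) / Re (w \<zeta>))) = (\<lambda>t. of_real t * ?\<tau>)"
      by (simp add: fun_eq_iff complex_eq_iff)
    ultimately have dcurve: "((\<lambda>x. S (Complex x c)) has_derivative (\<lambda>t. of_real t * ?\<tau>)) (at x)"
      by simp
    have "((\<lambda>\<zeta>. h \<zeta> + g \<zeta>) has_derivative (\<lambda>v. (h' \<zeta> + g' \<zeta>) * v)) (at \<zeta>)"
      using DERIV_add[OF h[OF \<zeta>] g[OF \<zeta>]] by (simp add: has_field_derivative_def)
    then have "((\<lambda>x. h (S (Complex x c)) + g (S (Complex x c))) has_derivative
        (\<lambda>t. (h' \<zeta> + g' \<zeta>) * (of_real t * ?\<tau>))) (at x)"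
      using has_derivative_compose[OF dcurve, of "\<lambda>\<zeta>. h \<zeta> + g \<zeta>"] that by simp
    from bounded_linear.has_derivative[OF bounded_linear_Re this]
    have "(R c has_derivative (\<lambda>t. Re ((h' \<zeta> + g' \<zeta>) * (of_real t * ?\<tau>)))) (at x)"
      by (simp add: R_def F_def harmonic_fun_def)
    moreover have "Re ((h' \<zeta> + g' \<zeta>) * (of_real t * ?\<tau>)) =
        ((norm (h' \<zeta>))\<^sup>2 - (norm (g' \<zeta>))\<^sup>2) / Re (w \<zeta>) * t" for t
    proof -
      have "(norm (h' \<zeta>))\<^sup>2 - (norm (g' \<zeta>))\<^sup>2 =
          Re (h' \<zeta> + g' \<zeta>) * Re (w \<zeta>) + Im (h' \<zeta> + g' \<zeta>) * Im (w \<zeta>)"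
        unfolding cmod_power2 w_def by (simp add: power2_eq_square algebra_simps)
      moreover have "Re (p * (of_real t * ?\<tau>)) =
          (Re p * Re (w \<zeta>) + Im p * Im (w \<zeta>)) / Re (w \<zeta>) * t" for p
        using w_pos[OF \<zeta>] by (simp add: field_simps)
      ultimately show ?thesis by (simp only:)
    qed
    ultimately show ?thesis unfolding has_field_derivative_def by (simp only:)
  qed
  have R_less: "R c x1 < R c x2" if "x1 \<in> I" "x2 \<in> I" "x1 < x2" for c x1 x2
  proof (rule DERIV_pos_imp_increasing[OF that(3)])
    fix x assume "x1 \<le> x" "x \<le> x2"
    then have x: "x \<in> I"
      using I(2) that by (meson is_interval_1 is_interval_connected_1)
    then have \<zeta>: "S (Complex x c) \<in> \<Omega>" by (intro S_in) (simp add: in_\<Omega>)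
    have "((norm (h' (S (Complex x c))))\<^sup>2 - (norm (g' (S (Complex x c))))\<^sup>2)
        / Re (w (S (Complex x c))) > 0"
      using dil[OF \<zeta>] w_pos[OF \<zeta>] by (simp add: power_strict_mono)
    then show "\<exists>y. (R c has_real_derivative y) (at x) \<and> 0 < y"
      using dR[OF x refl] by blast
  qed
  have F_S: "F \<zeta> = Complex (R (V \<zeta>) (Re \<zeta>)) (V \<zeta>)" if "\<zeta> \<in> \<Omega>" for \<zeta>
  proof -
    have "R (V \<zeta>) (Re \<zeta>) = Re (F \<zeta>)" using ST[OF that] by (simp add: R_def T_def)
    then show ?thesis by (simp add: complex_eq_iff ImF)
  qed
  have inj: "inj_on F \<Omega>"
  proof (rule inj_onI)
    fix \<zeta>1 \<zeta>2 assume A: "\<zeta>1 \<in> \<Omega>" "\<zeta>2 \<in> \<Omega>" "F \<zeta>1 = F \<zeta>2"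
    then have V: "V \<zeta>1 = V \<zeta>2" and "R (V \<zeta>1) (Re \<zeta>1) = R (V \<zeta>1) (Re \<zeta>2)"
      by (metis F_S complex.inject)+
    then have "Re \<zeta>1 = Re \<zeta>2"
      using A R_less[of "Re \<zeta>1" "Re \<zeta>2"] R_less[of "Re \<zeta>2" "Re \<zeta>1"]
      by (metis in_\<Omega> less_irrefl linorder_neqE)
    then have "T \<zeta>1 = T \<zeta>2" using V by (simp add: T_def)
    then show "\<zeta>1 = \<zeta>2" using A inj_T by (meson inj_onD)
  qed
  have contF: "continuous_on \<Omega> F"
  proof -
    have "continuous_on \<Omega> h" "continuous_on \<Omega> g"
      using h g by (meson DERIV_isCont continuous_at_imp_continuous_on)+
    then show ?thesis unfolding F_def harmonic_fun_def by (intro continuous_intros)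
  qed
  show "inj_on (harmonic_fun h g) \<Omega>" using inj by (simp add: F_def)
  show "open (harmonic_fun h g ` \<Omega>)"
    using invariance_of_domain[OF contF open_\<Omega> inj] by (simp add: F_def)
  show "connected (harmonic_fun h g ` \<Omega>)"
    using connected_continuous_image[OF contF convex_connected[OF conv_\<Omega>]] by (simp add: F_def)
  have "F ` \<Omega> \<inter> {w. Im w = c} = (\<lambda>x. Complex (R c x) c) ` I"
  proof (intro equalityI subsetI)
    fix p assume "p \<in> F ` \<Omega> \<inter> {w. Im w = c}"
    then show "p \<in> (\<lambda>x. Complex (R c x) c) ` I"
      using F_S ImF by (auto simp: in_\<Omega>)
  next
    fix p assume "p \<in> (\<lambda>x. Complex (R c x) c) ` I"
    then obtain x where x: "x \<in> I" "p = Complex (R c x) c" by blast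
    then have \<zeta>: "S (Complex x c) \<in> \<Omega>" "T (S (Complex x c)) = Complex x c"
      by (intro S_in TS; simp add: in_\<Omega>)+
    then have "p = F (S (Complex x c))"
      using F_S[OF \<zeta>(1)] x(2) by (simp add: T_def)
    then show "p \<in> F ` \<Omega> \<inter> {w. Im w = c}" using \<zeta>(1) x(2) by (metis (mono_tags) IntI complex.sel(2) imageI mem_Collect_eq)
  qed
  moreover have "continuous_on I (\<lambda>x. Complex (R c x) c)"
  proof -
    have "continuous_on I (R c)"
      using dR[OF _ refl] by (intro continuous_at_imp_continuous_on ballI) (rule DERIV_isCont)
    then show ?thesis unfolding Complex_eq by (intro continuous_intros)
  qed
  ultimately show "connected (harmonic_fun h g ` \<Omega> \<inter> {w. Im w = c})"
    using connected_continuous_image[OF _ I(2)] by (metis F_def)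
qed

section \<open>Conformal models of the disc\<close>

text \<open>For \<open>cos \<nu> = \<plusminus>1\<close> the quadratic \<open>1 - 2 u cos \<nu> + u\<^sup>2\<close> is a square, and the primitive of its reciprocal has as its
  inverse a Moebius map of a half-plane onto the disc; here \<open>(1 - u\<^sup>2) / (1 - c u)\<^sup>2\<close> is affine in the new variable.\<close>

lemma disc_model_half_plane:
  fixes c :: real
  assumes c: "c = 1 \<or> c = -1"
  defines "\<phi> \<equiv> \<lambda>\<zeta>. \<zeta> / (1 + of_real c * \<zeta>)" and "I \<equiv> {x. 1 + 2 * c * x > 0}"
  shows "open I" "connected I" "\<phi> ` (Re -` I) = \<DD>"
    and "\<And>\<zeta>. \<zeta> \<in> Re -` I \<Longrightarrow>
      (\<phi> has_field_derivative 1 - 2 * of_real c * \<phi> \<zeta> + (\<phi> \<zeta>)\<^sup>2) (at \<zeta>)"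
    and "\<And>\<zeta>. \<zeta> \<in> Re -` I \<Longrightarrow>
      Re ((1 - (\<phi> \<zeta>)\<^sup>2) / (1 - 2 * of_real c * \<phi> \<zeta> + (\<phi> \<zeta>)\<^sup>2)) = 1 + 2 * c * Re \<zeta>"
proof -
  show "open I" unfolding I_def by (intro open_Collect_less continuous_intros)
  have "convex I" unfolding I_def
  proof (rule convexI)
    fix x y u v :: real assume "x \<in> {x. 0 < 1 + 2 * c * x}" "y \<in> {x. 0 < 1 + 2 * c * x}"
      and uv: "0 \<le> u" "0 \<le> v" "u + v = 1"
    then have "u * (1 + 2 * c * x) + v * (1 + 2 * c * y) > 0"
      by (metis (no_types, lifting) add.commute add_nonneg_pos add_0 mem_Collect_eq mult_nonneg_nonneg mult_pos_pos less_eq_real_def zero_neq_one)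
    moreover have "u * (1 + 2 * c * x) + v * (1 + 2 * c * y) = (u + v) + 2 * c * (u * x + v * y)"
      by (simp add: algebra_simps)
    ultimately show "u *\<^sub>R x + v *\<^sub>R y \<in> {x. 0 < 1 + 2 * c * x}" using uv by simp
  qed
  then show "connected I" by (rule convex_connected)
  have nz: "1 + of_real c * \<zeta> \<noteq> 0" if "\<zeta> \<in> Re -` I" for \<zeta>
  proof
    assume "1 + of_real c * \<zeta> = 0"
    then have "1 + c * Re \<zeta> = 0" by (simp add: complex_eq_iff)
    then show False using that by (simp add: I_def)
  qed
  have iff: "norm \<zeta> < norm (1 + of_real c * \<zeta>) \<longleftrightarrow> \<zeta> \<in> Re -` I" for \<zeta>
  proof -
    have "norm \<zeta> < norm (1 + of_real c * \<zeta>) \<longleftrightarrow> (norm \<zeta>)\<^sup>2 < (norm (1 + of_real c * \<zeta>))\<^sup>2"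
      by (meson norm_ge_zero power2_less_imp_less power_strict_mono zero_less_numeral)
    also have "\<dots> \<longleftrightarrow> \<zeta> \<in> Re -` I"
      using c by (auto simp: cmod_power2 I_def) (auto simp: power2_eq_square algebra_simps)
    finally show ?thesis .
  qed
  show "\<phi> ` (Re -` I) = \<DD>"
  proof (intro equalityI subsetI)
    fix u assume "u \<in> \<phi> ` (Re -` I)"
    then obtain \<zeta> where \<zeta>: "\<zeta> \<in> Re -` I" "u = \<phi> \<zeta>" by blast
    then show "u \<in> \<DD>" using nz[OF \<zeta>(1)] iff[of \<zeta>] by (simp add: \<phi>_def norm_divide)
  next
    fix u :: complex assume "u \<in> \<DD>"
    then have u: "norm u < 1" by simp
    have nz': "1 - of_real c * u \<noteq> 0"
    proof
      assume "1 - of_real c * u = 0"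
      then have "norm (of_real c * u) = 1" by (metis eq_iff_diff_eq_0 norm_one)
      then show False using c u by (auto simp: norm_mult)
    qed
    define \<zeta> where "\<zeta> = u / (1 - of_real c * u)"
    have *: "1 + of_real c * \<zeta> = 1 / (1 - of_real c * u)"
      using nz' by (simp add: \<zeta>_def field_simps)
    then have "u = \<phi> \<zeta>" using nz' by (simp add: \<phi>_def) (simp add: \<zeta>_def)
    moreover have "\<zeta> \<in> Re -` I"
      unfolding iff[symmetric] * using u nz' by (simp add: \<zeta>_def norm_divide divide_strict_right_mono)
    ultimately show "u \<in> \<phi> ` (Re -` I)" by blast
  qed
  fix \<zeta> assume \<zeta>: "\<zeta> \<in> Re -` I"
  define d where "d = 1 + of_real c * \<zeta>"
  have d: "d \<noteq> 0" using nz[OF \<zeta>] by (simp add: d_def)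
  have cphi: "1 - of_real c * \<phi> \<zeta> = 1 / d"
    using d by (simp add: \<phi>_def field_simps d_def)
  have P: "1 - 2 * of_real c * \<phi> \<zeta> + (\<phi> \<zeta>)\<^sup>2 = 1 / d\<^sup>2"
  proof -
    have "1 - 2 * of_real c * \<phi> \<zeta> + (\<phi> \<zeta>)\<^sup>2 = (1 - of_real c * \<phi> \<zeta>)\<^sup>2"
      using c by (auto simp: power2_eq_square algebra_simps)
    then show ?thesis by (simp add: cphi power_divide)
  qed
  have "(\<phi> has_field_derivative 1 / d\<^sup>2) (at \<zeta>)"
    unfolding \<phi>_def d_def using nz[OF \<zeta>]
    by (auto intro!: derivative_eq_intros simp: power2_eq_square algebra_simps)
  then show "(\<phi> has_field_derivative 1 - 2 * of_real c * \<phi> \<zeta> + (\<phi> \<zeta>)\<^sup>2) (at \<zeta>)"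
    by (simp add: P)
  have "(1 - (\<phi> \<zeta>)\<^sup>2) / (1 - 2 * of_real c * \<phi> \<zeta> + (\<phi> \<zeta>)\<^sup>2) = d\<^sup>2 - (\<phi> \<zeta> * d)\<^sup>2"
    unfolding P using d by (simp add: field_simps)
  also have "\<phi> \<zeta> * d = \<zeta>" using nz[OF \<zeta>] by (simp add: \<phi>_def d_def)
  also have "d\<^sup>2 - \<zeta>\<^sup>2 = 1 + 2 * of_real c * \<zeta>"
    using c by (auto simp: d_def power2_eq_square algebra_simps)
  finally show "Re ((1 - (\<phi> \<zeta>)\<^sup>2) / (1 - 2 * of_real c * \<phi> \<zeta> + (\<phi> \<zeta>)\<^sup>2)) = 1 + 2 * c * Re \<zeta>"
    by simp
qed

lemma norm_sin_power2: "(norm (sin z))\<^sup>2 = (sin (Re z))\<^sup>2 + (sinh (Im z))\<^sup>2" for z :: complex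
proof -
  define e f where "e = exp (Im z)" and "f = exp (- Im z)"
  have ef: "e * f = 1" by (simp add: e_def f_def exp_minus)
  have "(norm (sin z))\<^sup>2 = (sin (Re z) * (e + f) / 2)\<^sup>2 + (cos (Re z) * (e - f) / 2)\<^sup>2"
    by (simp add: cmod_power2 Re_sin Im_sin e_def f_def)
  also have "\<dots> = (sin (Re z))\<^sup>2 * (e * f) + ((sin (Re z))\<^sup>2 + (cos (Re z))\<^sup>2) * ((e - f) / 2)\<^sup>2"
  proof -
    have "(a * (e + f) / 2)\<^sup>2 + (b * (e - f) / 2)\<^sup>2 = a\<^sup>2 * (e * f) + (a\<^sup>2 + b\<^sup>2) * ((e - f) / 2)\<^sup>2"
      for a b :: real
      by (simp add: power2_eq_square field_simps)
    then show ?thesis by metis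
  qed
  also have "\<dots> = (sin (Re z))\<^sup>2 + (sinh (Im z))\<^sup>2"
    unfolding ef by (simp add: sinh_field_def e_def f_def)
  finally show ?thesis .
qed

text \<open>This locates the strip: \<open>sin w / sin (w + \<nu>)\<close> lies in the disc exactly when \<open>2 Re w + \<nu>\<close> lies in \<open>(0, \<pi>)\<close>
  modulo \<open>2 \<pi>\<close>.\<close>

lemma norm_sin_less_iff:
  fixes w :: complex and \<nu> :: real
  assumes "sin \<nu> > 0"
  shows "norm (sin w) < norm (sin (w + of_real \<nu>)) \<longleftrightarrow> sin (2 * Re w + \<nu>) > 0"
proof -
  have "(norm (sin (w + of_real \<nu>)))\<^sup>2 - (norm (sin w))\<^sup>2 = (sin (Re w + \<nu>))\<^sup>2 - (sin (Re w))\<^sup>2"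
    by (simp add: norm_sin_power2)
  also have "\<dots> = sin (Re w + \<nu> + Re w) * sin (Re w + \<nu> - Re w)"
  proof -
    have "sin (a + b) * sin (a - b) = (sin a)\<^sup>2 - (sin b)\<^sup>2" for a b :: real
    proof -
      have "sin (a + b) * sin (a - b) = (sin a)\<^sup>2 * (cos b)\<^sup>2 - (cos a)\<^sup>2 * (sin b)\<^sup>2"
        by (simp add: sin_add sin_diff power2_eq_square algebra_simps)
      then show ?thesis by (simp add: cos_squared_eq algebra_simps)
    qed
    then show ?thesis by metis
  qed
  finally have "(norm (sin (w + of_real \<nu>)))\<^sup>2 - (norm (sin w))\<^sup>2 = sin (2 * Re w + \<nu>) * sin \<nu>"
    by (simp add: algebra_simps)
  moreover have "norm (sin w) < norm (sin (w + of_real \<nu>)) \<longleftrightarrow>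
      (norm (sin w))\<^sup>2 < (norm (sin (w + of_real \<nu>)))\<^sup>2"
    by (meson norm_ge_zero power2_less_imp_less power_strict_mono zero_less_numeral)
  ultimately show ?thesis using assms by (smt (verit) zero_less_mult_iff)
qed

text \<open>The zeros are \<open>cis \<nu>\<close> and \<open>cis (- \<nu>)\<close>, on the unit circle.\<close>

lemma quadratic_nonzero:
  fixes u :: complex and \<nu> :: real
  assumes "norm u < 1"
  shows "1 - 2 * of_real (cos \<nu>) * u + u\<^sup>2 \<noteq> 0"
proof -
  have cs: "cis \<nu> * cis (- \<nu>) = 1" "cis \<nu> + cis (- \<nu>) = 2 * of_real (cos \<nu>)"
    by (simp_all add: cis_mult complex_eq_iff)
  have "1 - 2 * of_real (cos \<nu>) * u + u\<^sup>2 = (u - cis \<nu>) * (u - cis (- \<nu>))"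
    unfolding cs(1)[symmetric] cs(2)[symmetric] by (simp add: power2_eq_square algebra_simps)
  then show ?thesis using assms by auto
qed

text \<open>The map \<open>\<phi>\<close> inverts the primitive of \<open>1 / (1 - 2 u cos \<nu> + u\<^sup>2)\<close>, which is a logarithm of
  \<open>(1 - u cis (- \<nu>)) / (1 - u cis \<nu>)\<close> up to a factor. In the strip variable
  \<open>(1 - u\<^sup>2) / (1 - 2 u cos \<nu> + u\<^sup>2) = sin (2 s \<zeta> + \<nu>) / s\<close>. Its real part is \<open>sin (2 s Re \<zeta> + \<nu>) cosh (2 s Im \<zeta>) / s\<close>,
  which on each vertical line is smallest at the real point.\<close>

lemma disc_model_strip:
  fixes \<nu> :: real
  assumes \<nu>: "0 < \<nu>" "\<nu> < pi"
  defines "s \<equiv> sin \<nu>"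
  defines "\<phi> \<equiv> \<lambda>\<zeta>. sin (of_real s * \<zeta>) / sin (of_real s * \<zeta> + of_real \<nu>)"
    and "I \<equiv> {x. 0 < 2 * s * x + \<nu> \<and> 2 * s * x + \<nu> < pi}"
  shows "open I" "connected I" "\<phi> ` (Re -` I) = \<DD>"
    and "\<And>\<zeta>. \<zeta> \<in> Re -` I \<Longrightarrow>
      (\<phi> has_field_derivative 1 - 2 * of_real (cos \<nu>) * \<phi> \<zeta> + (\<phi> \<zeta>)\<^sup>2) (at \<zeta>)"
    and "\<And>\<zeta>. \<zeta> \<in> Re -` I \<Longrightarrow>
      Re ((1 - (\<phi> \<zeta>)\<^sup>2) / (1 - 2 * of_real (cos \<nu>) * \<phi> \<zeta> + (\<phi> \<zeta>)\<^sup>2))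
        \<ge> sin (2 * s * Re \<zeta> + \<nu>) / s"
proof -
  have s: "s > 0" using \<nu> by (simp add: s_def sin_gt_zero)
  have I_eq: "I = {- \<nu> / (2 * s)<..<(pi - \<nu>) / (2 * s)}"
    using s by (auto simp: I_def field_simps)
  show "open I" "connected I" unfolding I_eq by auto
  have lt: "norm (sin (of_real s * \<zeta>)) < norm (sin (of_real s * \<zeta> + of_real \<nu>))"
    if "\<zeta> \<in> Re -` I" for \<zeta>
    using that s by (subst norm_sin_less_iff) (auto simp: s_def[symmetric] I_def mult.assoc intro!: sin_gt_zero)
  have nz: "sin (of_real s * \<zeta> + of_real \<nu>) \<noteq> 0" if "\<zeta> \<in> Re -` I" for \<zeta>
    using lt[OF that] by auto
  show "\<phi> ` (Re -` I) = \<DD>"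
  proof (intro equalityI subsetI)
    fix u assume "u \<in> \<phi> ` (Re -` I)"
    then show "u \<in> \<DD>" using lt nz by (auto simp: \<phi>_def norm_divide)
  next
    fix u :: complex assume "u \<in> \<DD>"
    then have u: "norm u < 1" by simp
    define c where "c = cos \<nu>"
    have cs: "of_real c * of_real c + of_real s * of_real s = (1::complex)"
      unfolding c_def s_def of_real_mult[symmetric] of_real_add[symmetric]
      by (metis of_real_1 power2_eq_square sin_cos_squared_add2)
    have nz1: "1 - u * of_real c \<noteq> 0"
    proof
      assume "1 - u * of_real c = 0"
      then have "norm (u * of_real c) = 1" by (metis eq_iff_diff_eq_0 norm_one)
      moreover have "norm (u * of_real c) \<le> norm u * 1"
        unfolding norm_mult by (intro mult_left_mono) (auto simp: c_def)
      ultimately show False using u by simp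
    qed
    \<comment> \<open>The equation \<open>sin \<theta> = u * sin (\<theta> + \<nu>)\<close> is linear in \<open>sin \<theta>\<close> and \<open>cos \<theta>\<close>, hence an equation \<open>tan \<theta> = b\<close>.\<close>
    define b where "b = u * of_real s / (1 - u * of_real c)"
    define \<theta> where "\<theta> = Arctan b"
    have "b\<^sup>2 \<noteq> -1"
    proof
      assume "b\<^sup>2 = -1"
      then have "(u * of_real s)\<^sup>2 + (1 - u * of_real c)\<^sup>2 = 0"
        using nz1 by (simp add: b_def power_divide divide_eq_eq)
      then have "1 - 2 * of_real c * u + u\<^sup>2 * (of_real c * of_real c + of_real s * of_real s) = 0"
        by (simp add: power2_eq_square algebra_simps)
      then show False using quadratic_nonzero[OF u] by (simp add: cs) (simp add: c_def)
    qed
    then have tan: "tan \<theta> = b" by (simp add: \<theta>_def)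
    have cos\<theta>: "cos \<theta> \<noteq> 0"
    proof
      assume 0: "cos \<theta> = 0"
      then have "b = 0" using tan by (simp add: tan_def)
      then show False using 0 by (simp add: \<theta>_def)
    qed
    have rel: "sin \<theta> = u * sin (\<theta> + of_real \<nu>)"
    proof -
      have "sin \<theta> * (1 - u * of_real c) = u * of_real s * cos \<theta>"
        using tan cos\<theta> nz1 by (simp add: tan_def b_def field_simps)
      then show ?thesis by (simp add: sin_add c_def s_def sin_of_real cos_of_real algebra_simps)
    qed
    have nz2: "sin (\<theta> + of_real \<nu>) \<noteq> 0"
    proof
      assume 0: "sin (\<theta> + of_real \<nu>) = 0"
      then have "sin \<theta> = 0" using rel by simp
      then have "cos \<theta> * of_real s = 0" using 0 by (simp add: sin_add s_def sin_of_real)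
      then show False using cos\<theta> s by simp
    qed
    have "norm (sin \<theta>) < norm (sin (\<theta> + of_real \<nu>))"
      unfolding rel norm_mult using u nz2 by simp
    then have pos: "sin (2 * Re \<theta> + \<nu>) > 0"
      using s by (subst (asm) norm_sin_less_iff) (auto simp: s_def)
    \<comment> \<open>Translating \<open>\<theta>\<close> by a multiple of \<open>\<pi>\<close> leaves the quotient of sines unchanged and moves \<open>\<theta>\<close> into
        the strip.\<close>
    define k where "k = \<lfloor>(2 * Re \<theta> + \<nu>) / (2 * pi)\<rfloor>"
    define \<zeta> where "\<zeta> = (\<theta> - of_real (of_int k * pi)) / of_real s"
    have s\<zeta>: "of_real s * \<zeta> = \<theta> - of_real (of_int k * pi)" using s by (simp add: \<zeta>_def)
    define \<beta> where "\<beta> = 2 * s * Re \<zeta> + \<nu>"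
    have \<beta>: "\<beta> = 2 * Re \<theta> + \<nu> - 2 * pi * of_int k"
    proof -
      have "s * Re \<zeta> = Re \<theta> - of_int k * pi" using arg_cong[OF s\<zeta>, of Re] by simp
      then show ?thesis by (simp add: \<beta>_def algebra_simps)
    qed
    have "0 \<le> \<beta>" "\<beta> < 2 * pi"
    proof -
      have "of_int k \<le> (2 * Re \<theta> + \<nu>) / (2 * pi)" "(2 * Re \<theta> + \<nu>) / (2 * pi) < of_int k + 1"
        unfolding k_def by linarith+
      then show "0 \<le> \<beta>" "\<beta> < 2 * pi" unfolding \<beta> by (simp_all add: field_simps)
    qed
    moreover have "sin \<beta> > 0"
      using pos unfolding \<beta> by (simp add: sin_diff)
    ultimately have "0 < \<beta>" "\<beta> < pi"
      by (auto simp: less_le) (metis less_le not_less sin_le_zero sin_zero)+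
    then have "\<zeta> \<in> Re -` I" by (simp add: I_def \<beta>_def)
    moreover have "\<phi> \<zeta> = u"
    proof -
      have sink: "sin (of_int k * of_real pi :: complex) = 0"
        unfolding sin_eq_0 by (rule exI[of _ k]) simp
      then have cosk: "cos (of_int k * of_real pi :: complex) \<noteq> 0"
        using sin_cos_squared_add[of "of_int k * of_real pi :: complex"] by auto
      have "\<phi> \<zeta> = sin \<theta> / sin (\<theta> + of_real \<nu>)"
        using cosk sink by (simp add: \<phi>_def s\<zeta> diff_add_eq sin_diff)
      then show ?thesis using nz2 by (simp add: rel)
    qed
    ultimately show "u \<in> \<phi> ` (Re -` I)" by blast
  qed
  fix \<zeta> assume \<zeta>: "\<zeta> \<in> Re -` I"
  define A B where "A = sin (of_real s * \<zeta>)" and "B = sin (of_real s * \<zeta> + of_real \<nu>)"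
  define C E where "C = cos (of_real s * \<zeta>)" and "E = cos (of_real s * \<zeta> + of_real \<nu>)"
  define S K where "S = (of_real s :: complex)" and "K = (of_real (cos \<nu>) :: complex)"
  have B: "B \<noteq> 0" using nz[OF \<zeta>] by (simp add: B_def)
  have S: "S \<noteq> 0" using s by (simp add: S_def)
  have rels: "B = A * K + C * S" "E = C * K - A * S"
    by (simp_all add: A_def B_def C_def E_def S_def K_def s_def sin_add cos_add sin_of_real cos_of_real)
  have AC: "A\<^sup>2 + C\<^sup>2 = 1" by (simp add: A_def C_def)
  have SK: "S\<^sup>2 + K\<^sup>2 = 1" by (simp add: S_def K_def s_def flip: sin_of_real cos_of_real)
  have phi: "\<phi> \<zeta> = A / B" by (simp add: \<phi>_def A_def B_def)
  have quad: "B\<^sup>2 - 2 * K * A * B + A\<^sup>2 = S\<^sup>2"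
    unfolding rels using AC SK by algebra
  have P: "1 - 2 * K * \<phi> \<zeta> + (\<phi> \<zeta>)\<^sup>2 = S\<^sup>2 / B\<^sup>2"
    unfolding quad[symmetric] phi using B by (simp add: field_simps power2_eq_square)
  have "(\<phi> has_field_derivative (C * S * B - A * (E * S)) / (B * B)) (at \<zeta>)"
    unfolding \<phi>_def using nz[OF \<zeta>]
    by (auto intro!: derivative_eq_intros simp: A_def B_def C_def E_def S_def)
  moreover have "C * S * B - A * (E * S) = S\<^sup>2"
    unfolding rels using AC SK by algebra
  ultimately show "(\<phi> has_field_derivative 1 - 2 * of_real (cos \<nu>) * \<phi> \<zeta> + (\<phi> \<zeta>)\<^sup>2) (at \<zeta>)"
    using P by (simp add: K_def power2_eq_square)
  have "(1 - (\<phi> \<zeta>)\<^sup>2) / (1 - 2 * K * \<phi> \<zeta> + (\<phi> \<zeta>)\<^sup>2) = (B\<^sup>2 - A\<^sup>2) / S\<^sup>2"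
    unfolding P using B S by (simp add: phi field_simps)
  also have "B\<^sup>2 - A\<^sup>2 = S * (A * E + C * B)"
    unfolding rels using AC SK by algebra
  also have "A * E + C * B = sin (of_real s * \<zeta> + (of_real s * \<zeta> + of_real \<nu>))"
    unfolding A_def B_def C_def E_def by (rule sin_add[symmetric])
  finally have q: "(1 - (\<phi> \<zeta>)\<^sup>2) / (1 - 2 * K * \<phi> \<zeta> + (\<phi> \<zeta>)\<^sup>2) =
      sin (of_real s * \<zeta> + (of_real s * \<zeta> + of_real \<nu>)) / of_real s"
    using S by (simp add: S_def power2_eq_square)
  define y where "y = 2 * s * Im \<zeta>"
  have "Re ((1 - (\<phi> \<zeta>)\<^sup>2) / (1 - 2 * K * \<phi> \<zeta> + (\<phi> \<zeta>)\<^sup>2)) =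
      sin (2 * s * Re \<zeta> + \<nu>) / s * cosh y"
    unfolding q by (simp add: Re_divide_of_real Re_sin cosh_field_def y_def mult_ac)
  moreover have "sin (2 * s * Re \<zeta> + \<nu>) / s \<ge> 0"
    using \<zeta> s sin_gt_zero[of "2 * s * Re \<zeta> + \<nu>"] by (simp add: I_def)
  ultimately show "Re ((1 - (\<phi> \<zeta>)\<^sup>2) / (1 - 2 * of_real (cos \<nu>) * \<phi> \<zeta> + (\<phi> \<zeta>)\<^sup>2))
        \<ge> sin (2 * s * Re \<zeta> + \<nu>) / s"
    using mult_left_mono[OF cosh_real_ge_1[of y], of "sin (2 * s * Re \<zeta> + \<nu>) / s"]
    by (simp add: K_def)
qed

text \<open>Only \<open>cos \<nu>\<close> matters, so \<open>\<nu>\<close> may be replaced by \<open>arccos (cos \<nu>)\<close>, which lies in \<open>[0, \<pi>]\<close>; the endpoints are the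
  half-plane cases.\<close>

lemma disc_model:
  fixes \<nu> :: real
  obtains \<phi> :: "complex \<Rightarrow> complex" and I :: "real set" and \<delta> :: "real \<Rightarrow> real"
  where "open I" "connected I" "\<phi> ` (Re -` I) = \<DD>"
    and "\<And>x. x \<in> I \<Longrightarrow> \<delta> x > 0"
    and "\<And>\<zeta>. \<zeta> \<in> Re -` I \<Longrightarrow>
      (\<phi> has_field_derivative 1 - 2 * of_real (cos \<nu>) * \<phi> \<zeta> + (\<phi> \<zeta>)\<^sup>2) (at \<zeta>)"
    and "\<And>\<zeta>. \<zeta> \<in> Re -` I \<Longrightarrow>
      Re ((1 - (\<phi> \<zeta>)\<^sup>2) / (1 - 2 * of_real (cos \<nu>) * \<phi> \<zeta> + (\<phi> \<zeta>)\<^sup>2)) \<ge> \<delta> (Re \<zeta>)"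
proof (cases "cos \<nu> = 1 \<or> cos \<nu> = -1")
  case True
  from disc_model_half_plane[OF this] show ?thesis
    by (intro that[of "{x. 0 < 1 + 2 * cos \<nu> * x}" "\<lambda>\<zeta>. \<zeta> / (1 + of_real (cos \<nu>) * \<zeta>)"
          "\<lambda>x. 1 + 2 * cos \<nu> * x"]) auto
next
  case False
  define \<nu>' where "\<nu>' = arccos (cos \<nu>)"
  have cos: "cos \<nu>' = cos \<nu>" by (simp add: \<nu>'_def)
  have "0 \<le> \<nu>'" "\<nu>' \<le> pi" by (simp_all add: \<nu>'_def arccos_lbound arccos_ubound)
  moreover have "\<nu>' \<noteq> 0" "\<nu>' \<noteq> pi" using False cos by auto
  ultimately have \<nu>': "0 < \<nu>'" "\<nu>' < pi" by auto
  define s where "s = sin \<nu>'"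
  have s: "s > 0" using \<nu>' by (simp add: s_def sin_gt_zero)
  note model = disc_model_strip[OF \<nu>', folded s_def, unfolded cos]
  show ?thesis
    by (rule that[OF model(1-3) _ model(4,5)]) (use s in \<open>auto intro!: divide_pos_pos sin_gt_zero\<close>)
qed

lemma Re_quotient_pos:
  fixes u :: complex and \<nu> :: real
  assumes "norm u < 1"
  shows "Re ((1 - u\<^sup>2) / (1 - 2 * of_real (cos \<nu>) * u + u\<^sup>2)) > 0"
proof -
  from disc_model[of \<nu>] obtain \<phi> :: "complex \<Rightarrow> complex" and I \<delta> where "\<phi> ` (Re -` I) = \<DD>"
    and \<delta>: "\<And>x. x \<in> I \<Longrightarrow> \<delta> x > (0::real)"
    and q: "\<And>\<zeta>. \<zeta> \<in> Re -` I \<Longrightarrow>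
      Re ((1 - (\<phi> \<zeta>)\<^sup>2) / (1 - 2 * of_real (cos \<nu>) * \<phi> \<zeta> + (\<phi> \<zeta>)\<^sup>2)) \<ge> \<delta> (Re \<zeta>)"
    by metis
  then obtain \<zeta> where "\<zeta> \<in> Re -` I" "u = \<phi> \<zeta>" using assms by (metis imageE mem_ball_0)
  then show ?thesis using \<delta>[of "Re \<zeta>"] q[of \<zeta>] by simp
qed

section \<open>A criterion for convexity in one direction\<close>

text \<open>Multiplication by \<open>cis \<alpha>\<close> turns the lines of direction \<open>cis (- \<alpha>)\<close> into the horizontal lines.\<close>

lemma convex_in_direction_rotate:
  assumes "\<And>c. connected ((\<lambda>w. cis \<alpha> * w) ` S \<inter> {w. Im w = c})"
  shows "convex_in_direction (- \<alpha>) S"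
  unfolding convex_in_direction_def
proof
  fix p :: complex
  have cc: "cis (- \<alpha>) * (cis \<alpha> * w) = w" "cis \<alpha> * (cis (- \<alpha>) * w) = w" for w
    by (simp_all add: cis_mult flip: mult.assoc)
  define c where "c = Im (cis \<alpha> * p)"
  have on_line: "w \<in> range (\<lambda>t::real. p + of_real t * cis (- \<alpha>)) \<longleftrightarrow> Im (cis \<alpha> * w) = c" for w
  proof
    assume "w \<in> range (\<lambda>t::real. p + of_real t * cis (- \<alpha>))"
    then obtain t :: real where "w = p + of_real t * cis (- \<alpha>)" by blast
    then have "cis \<alpha> * w = cis \<alpha> * p + of_real t"
      using cc(2)[of "of_real t"] by (simp add: distrib_left mult_ac)
    then show "Im (cis \<alpha> * w) = c" by (simp add: c_def)
  next
    assume "Im (cis \<alpha> * w) = c"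
    then have "cis \<alpha> * w = cis \<alpha> * p + of_real (Re (cis \<alpha> * w) - Re (cis \<alpha> * p))"
      by (simp add: c_def complex_eq_iff)
    then have "w = p + of_real (Re (cis \<alpha> * w) - Re (cis \<alpha> * p)) * cis (- \<alpha>)"
      by (metis cc(1) distrib_left mult.commute)
    then show "w \<in> range (\<lambda>t::real. p + of_real t * cis (- \<alpha>))" by blast
  qed
  have "S \<inter> range (\<lambda>t::real. p + of_real t * cis (- \<alpha>)) =
      (\<lambda>w. cis (- \<alpha>) * w) ` ((\<lambda>w. cis \<alpha> * w) ` S \<inter> {w. Im w = c})"
    using on_line by (force simp: cc image_iff)
  then show "connected (S \<inter> range (\<lambda>t::real. p + of_real t * cis (- \<alpha>)))"
    using assms by (auto intro!: connected_continuous_image continuous_intros)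
qed

text \<open>A harmonic form of the Royster--Ziegler criterion. For analytic functions (\<open>G = 0\<close>) that criterion
  asks for a nonnegative real part of \<open>H' Q\<close>, up to rotation. The stronger lower bound by \<open>(1 - u\<^sup>2) / Q\<close>, the
  value of \<open>H' Q\<close> for the slit map \<open>u / Q\<close>, is what makes \<open>Im F\<close> unbounded in both directions on every
  vertical line of the model.\<close>

theorem royster_ziegler_harmonic:
  fixes H G H' G' :: "complex \<Rightarrow> complex" and \<alpha> \<nu> \<epsilon> :: real
  defines "Q \<equiv> \<lambda>u. 1 - 2 * of_real (cos \<nu>) * u + u\<^sup>2"
  assumes H: "\<And>z. z \<in> \<DD> \<Longrightarrow> (H has_field_derivative H' z) (at z)"
    and G: "\<And>z. z \<in> \<DD> \<Longrightarrow> (G has_field_derivative G' z) (at z)"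
    and dil: "\<And>z. z \<in> \<DD> \<Longrightarrow> norm (G' z) < norm (H' z)"
    and \<epsilon>: "\<epsilon> > 0"
    and pos: "\<And>z. z \<in> \<DD> \<Longrightarrow> Re ((H' z - cis (- (2 * \<alpha>)) * G' z) * Q (cis \<alpha> * z))
        \<ge> \<epsilon> * Re ((1 - (cis \<alpha> * z)\<^sup>2) / Q (cis \<alpha> * z))"
  shows "inj_on (harmonic_fun H G) \<DD> \<and> maps_disc_convex_in_direction (- \<alpha>) (harmonic_fun H G)"
proof -
  obtain \<phi> I \<delta> where I: "open I" "connected I" and \<phi>_surj: "\<phi> ` (Re -` I) = \<DD>"
    and \<delta>: "\<And>x. x \<in> I \<Longrightarrow> \<delta> x > (0::real)"
    and d\<phi>: "\<And>\<zeta>. \<zeta> \<in> Re -` I \<Longrightarrow> (\<phi> has_field_derivative Q (\<phi> \<zeta>)) (at \<zeta>)"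
    and q: "\<And>\<zeta>. \<zeta> \<in> Re -` I \<Longrightarrow> Re ((1 - (\<phi> \<zeta>)\<^sup>2) / Q (\<phi> \<zeta>)) \<ge> \<delta> (Re \<zeta>)"
    unfolding Q_def using disc_model[of \<nu>] by metis
  define \<psi> where "\<psi> = (\<lambda>\<zeta>. cis (- \<alpha>) * \<phi> \<zeta>)"
  define h g where "h = (\<lambda>\<zeta>. cis \<alpha> * H (\<psi> \<zeta>))" and "g = (\<lambda>\<zeta>. cis (- \<alpha>) * G (\<psi> \<zeta>))"
  have cc: "cis \<alpha> * (cis (- \<alpha>) * w) = w" "cis (- \<alpha>) * (cis \<alpha> * w) = w"
    "cis (- \<alpha>) * (cis (- \<alpha>) * w) = cis (- (2 * \<alpha>)) * w" for w
    by (simp_all add: cis_mult flip: mult.assoc)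
  have \<psi>_surj: "\<psi> ` (Re -` I) = \<DD>"
  proof (intro equalityI subsetI)
    fix z assume "z \<in> \<psi> ` (Re -` I)"
    then show "z \<in> \<DD>" using \<phi>_surj by (auto simp: \<psi>_def norm_mult)
  next
    fix z assume "z \<in> \<DD>"
    then have "cis \<alpha> * z \<in> \<phi> ` (Re -` I)" unfolding \<phi>_surj by (simp add: norm_mult)
    then obtain \<zeta> where "\<zeta> \<in> Re -` I" "\<phi> \<zeta> = cis \<alpha> * z" by auto
    then have "\<zeta> \<in> Re -` I" "z = \<psi> \<zeta>" by (simp_all add: \<psi>_def cc)
    then show "z \<in> \<psi> ` (Re -` I)" by blast
  qed
  have Q0: "Q (\<phi> \<zeta>) \<noteq> 0" if "\<zeta> \<in> Re -` I" for \<zeta>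
    unfolding Q_def using \<phi>_surj that by (intro quadratic_nonzero) auto
  have d\<psi>: "(\<psi> has_field_derivative cis (- \<alpha>) * Q (\<phi> \<zeta>)) (at \<zeta>)" if "\<zeta> \<in> Re -` I" for \<zeta>
    unfolding \<psi>_def by (intro DERIV_cmult d\<phi> that)
  have \<psi>_in: "\<psi> \<zeta> \<in> \<DD>" if "\<zeta> \<in> Re -` I" for \<zeta> using \<psi>_surj that by blast
  have h: "(h has_field_derivative H' (\<psi> \<zeta>) * Q (\<phi> \<zeta>)) (at \<zeta>)" if "\<zeta> \<in> Re -` I" for \<zeta>
    using DERIV_cmult[OF DERIV_chain2[OF H[OF \<psi>_in[OF that]] d\<psi>[OF that]], of "cis \<alpha>"]
    by (simp add: h_def cc mult.left_commute[of "H' _"])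
  have g: "(g has_field_derivative cis (- (2 * \<alpha>)) * G' (\<psi> \<zeta>) * Q (\<phi> \<zeta>)) (at \<zeta>)"
    if "\<zeta> \<in> Re -` I" for \<zeta>
    using DERIV_cmult[OF DERIV_chain2[OF G[OF \<psi>_in[OF that]] d\<psi>[OF that]], of "cis (- \<alpha>)"]
    by (simp add: g_def cc mult.left_commute[of "G' _"] mult.assoc)
  have F: "harmonic_fun h g \<zeta> = cis \<alpha> * harmonic_fun H G (\<psi> \<zeta>)" for \<zeta>
    by (simp add: harmonic_fun_def h_def g_def cis_cnj distrib_left)
  have shear: "inj_on (harmonic_fun h g) (Re -` I)" "open (harmonic_fun h g ` (Re -` I))"
    "connected (harmonic_fun h g ` (Re -` I))"
    "connected (harmonic_fun h g ` (Re -` I) \<inter> {w. Im w = c})" for c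
  proof -
    have dil': "norm (cis (- (2 * \<alpha>)) * G' (\<psi> \<zeta>) * Q (\<phi> \<zeta>)) < norm (H' (\<psi> \<zeta>) * Q (\<phi> \<zeta>))"
      if "\<zeta> \<in> Re -` I" for \<zeta>
      using dil[OF \<psi>_in[OF that]] Q0[OF that] by (simp add: norm_mult)
    have pos': "Re (H' (\<psi> \<zeta>) * Q (\<phi> \<zeta>) - cis (- (2 * \<alpha>)) * G' (\<psi> \<zeta>) * Q (\<phi> \<zeta>)) \<ge> \<epsilon> * \<delta> (Re \<zeta>)"
      if "\<zeta> \<in> Re -` I" for \<zeta>
    proof -
      have "cis \<alpha> * \<psi> \<zeta> = \<phi> \<zeta>" by (simp add: \<psi>_def cc)
      then have "Re ((H' (\<psi> \<zeta>) - cis (- (2 * \<alpha>)) * G' (\<psi> \<zeta>)) * Q (\<phi> \<zeta>)) \<ge>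
          \<epsilon> * Re ((1 - (\<phi> \<zeta>)\<^sup>2) / Q (\<phi> \<zeta>))"
        using pos[OF \<psi>_in[OF that]] by simp
      moreover have "\<epsilon> * Re ((1 - (\<phi> \<zeta>)\<^sup>2) / Q (\<phi> \<zeta>)) \<ge> \<epsilon> * \<delta> (Re \<zeta>)"
        using q[OF that] \<epsilon> by (intro mult_left_mono) auto
      ultimately show ?thesis by (simp only: left_diff_distrib)
    qed
    have \<delta>': "\<epsilon> * \<delta> x > 0" if "x \<in> I" for x using \<delta>[OF that] \<epsilon> by simp
    note * = strip_shear[OF I h g dil' \<delta>' pos']
    show "inj_on (harmonic_fun h g) (Re -` I)" "open (harmonic_fun h g ` (Re -` I))"
      "connected (harmonic_fun h g ` (Re -` I))"
      "connected (harmonic_fun h g ` (Re -` I) \<inter> {w. Im w = c})"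
      by (rule *; assumption)+
  qed
  have image: "harmonic_fun h g ` (Re -` I) = (\<lambda>w. cis \<alpha> * w) ` (harmonic_fun H G ` \<DD>)"
    unfolding \<psi>_surj[symmetric] image_image F ..
  have unrotate: "harmonic_fun H G ` \<DD> = (\<lambda>w. cis (- \<alpha>) * w) ` (harmonic_fun h g ` (Re -` I))"
    unfolding image by (simp add: image_image cc)
  have "inj_on (harmonic_fun H G) \<DD>"
  proof (rule inj_onI)
    fix z1 z2 assume "z1 \<in> \<DD>" "z2 \<in> \<DD>" and eq: "harmonic_fun H G z1 = harmonic_fun H G z2"
    then obtain \<zeta>1 \<zeta>2 where *: "\<zeta>1 \<in> Re -` I" "\<zeta>2 \<in> Re -` I" "z1 = \<psi> \<zeta>1" "z2 = \<psi> \<zeta>2"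
      using \<psi>_surj by (metis imageE)
    then have "harmonic_fun h g \<zeta>1 = harmonic_fun h g \<zeta>2" using eq by (simp add: F)
    then show "z1 = z2" using shear(1) * by (metis inj_onD)
  qed
  moreover have "open (harmonic_fun H G ` \<DD>)"
  proof -
    have "harmonic_fun H G ` \<DD> = (\<lambda>w. cis \<alpha> * w) -` (harmonic_fun h g ` (Re -` I))"
      unfolding image by auto
    then show ?thesis using open_vimage[OF shear(2), of "\<lambda>w. cis \<alpha> * w"]
      by (simp add: continuous_on_mult_left)
  qed
  moreover have "connected (harmonic_fun H G ` \<DD>)"
    unfolding unrotate by (rule connected_continuous_image[OF _ shear(3)]) (intro continuous_intros)
  moreover have "convex_in_direction (- \<alpha>) (harmonic_fun H G ` \<DD>)"
    using shear(4) unfolding image by (rule convex_in_direction_rotate)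
  ultimately show ?thesis by (simp add: maps_disc_convex_in_direction_def)
qed

section \<open>The dilatation inequality\<close>

text \<open>After multiplication by \<open>D\<close> the difference is a quadratic polynomial in \<open>Im q\<close>; the right-hand side is
  the result of completing the square, arranged so that \<open>q\<close> enters only through squares and the factor \<open>s\<close>.\<close>

lemma norm_square_gap:
  fixes q w :: complex and m :: real
  defines "r \<equiv> norm w" and "x \<equiv> Re w" and "y \<equiv> Im w" and "s \<equiv> Re q" and "t \<equiv> Im q"
  defines "D \<equiv> (norm (1 + w))\<^sup>2"
  shows "D * ((norm (q * (1 + w) + 1 - (m - 1) * w))\<^sup>2 - (norm (w * (q * (1 + w) + m - 1 - w)))\<^sup>2) =
     (1 - r\<^sup>2) * ((D * t - m * y)\<^sup>2 + (D * s)\<^sup>2)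
     + 2 * s * D * ((1 + r\<^sup>2)\<^sup>2 - 2 * m * r\<^sup>2 - (m - 2) * (1 + r\<^sup>2) * x)
     + (1 - r\<^sup>2) * ((1 + r\<^sup>2 - (m - 2) * x)\<^sup>2 - m\<^sup>2 * r\<^sup>2)"
proof -
  have r2: "r\<^sup>2 = x\<^sup>2 + y\<^sup>2" by (simp add: r_def x_def y_def cmod_power2)
  have D: "D = 1 + 2 * x + r\<^sup>2"
    unfolding D_def r2 by (simp add: cmod_power2 x_def y_def) (simp add: power2_eq_square algebra_simps)
  have 1: "(norm (q * (1 + w) + 1 - (m - 1) * w))\<^sup>2 =
      (s * (1 + x) - t * y + 1 - (m - 1) * x)\<^sup>2 + (s * y + t * (1 + x) - (m - 1) * y)\<^sup>2"
    by (simp add: cmod_power2 s_def t_def x_def y_def)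
  have 2: "(norm (w * (q * (1 + w) + m - 1 - w)))\<^sup>2 =
      r\<^sup>2 * ((s * (1 + x) - t * y + m - 1 - x)\<^sup>2 + (s * y + t * (1 + x) - y)\<^sup>2)"
    by (simp add: norm_mult power_mult_distrib r_def) (simp add: cmod_power2 s_def t_def x_def y_def)
  show ?thesis unfolding 1 2 D r2 by algebra
qed

text \<open>In the notation of the proof the two coefficients to be controlled are \<open>Y\<^sup>2 - 2 m r\<^sup>2 - (m - 2) Y x\<close> and
  \<open>(Y - (m - 2) x)\<^sup>2 - m\<^sup>2 r\<^sup>2\<close>. For \<open>m \<ge> 2\<close> both are smallest at \<open>x = r\<close>, where the first factors as
  \<open>(Y - m r) (Y + 2 r)\<close> and the second is nonnegative exactly if \<open>Y \<ge> 2 (m - 1) r\<close>. For \<open>m < 2\<close> the extreme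
  case is \<open>x = - r\<close>, where \<open>Y > 2 r\<close> suffices.\<close>

lemma dilatation_bound:
  fixes q w :: complex and m :: real
  assumes q: "Re q > 0" and w: "norm w < 1" and m: "m \<ge> 1"
    and key: "2 * (m - 1) * norm w \<le> 1 + (norm w)\<^sup>2"
  shows "norm (w * (q * (1 + w) + m - 1 - w)) < norm (q * (1 + w) + 1 - (m - 1) * w)"
proof -
  define r x Y where "r = norm w" and "x = Re w" and "Y = 1 + r\<^sup>2"
  define D where "D = (norm (1 + w))\<^sup>2"
  have r: "0 \<le> r" "r < 1" and xr: "\<bar>x\<bar> \<le> r"
    using w by (auto simp: r_def x_def abs_Re_le_cmod)
  have "r\<^sup>2 < 1" using r by (simp add: power_less_one_iff abs_square_less_1)
  have "1 + w \<noteq> 0" using w by (metis add.commute add_eq_0_iff2 norm_minus_cancel norm_one less_irrefl)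
  then have D: "D > 0" by (simp add: D_def)
  have Y2: "Y > 2 * r"
    using r zero_less_power2[of "1 - r"] by (simp add: Y_def power2_eq_square algebra_simps)
  have Ym: "Y \<ge> 2 * (m - 1) * r" using key by (simp add: Y_def r_def)
  have Ym': "Y > m * r"
  proof (cases "m \<ge> 2")
    case True
    show ?thesis
    proof (cases "m = 2 \<or> r = 0")
      case True then show ?thesis using Y2 by auto
    next
      case False
      then have "(m - 2) * r > 0" using True r by simp
      then show ?thesis using Ym by (simp add: algebra_simps)
    qed
  next
    case False
    then have "m * r \<le> 2 * r" using r by (intro mult_right_mono) auto
    then show ?thesis using Y2 by simp
  qed
  have Yx: "Y - (m - 2) * x \<ge> m * r"
  proof (cases "m \<ge> 2")
    case True
    have "(m - 2) * x \<le> (m - 2) * r" using True xr by (intro mult_left_mono) auto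
    then show ?thesis using Ym by (simp add: algebra_simps)
  next
    case False
    have "(2 - m) * (-x) \<le> (2 - m) * r" using False xr by (intro mult_left_mono) auto
    then show ?thesis using Y2 by (simp add: algebra_simps)
  qed
  have L: "Y\<^sup>2 - 2 * m * r\<^sup>2 - (m - 2) * Y * x > 0"
  proof (cases "m \<ge> 2")
    case True
    have "(m - 2) * Y * x \<le> (m - 2) * Y * r" using True xr Y2 r by (intro mult_left_mono mult_nonneg_nonneg) auto
    moreover have "(Y - m * r) * (Y + 2 * r) > 0" using Ym' Y2 r by (intro mult_pos_pos) auto
    ultimately show ?thesis by (simp add: algebra_simps power2_eq_square)
  next
    case False
    have "(2 - m) * Y * (-x) \<le> (2 - m) * Y * r" using False xr Y2 r by (intro mult_left_mono mult_nonneg_nonneg) auto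
    moreover have "(Y - 2 * r) * (Y + m * r) > 0" using Y2 r m by (intro mult_pos_pos add_pos_nonneg mult_nonneg_nonneg) auto
    ultimately show ?thesis by (simp add: algebra_simps power2_eq_square)
  qed
  have M: "(Y - (m - 2) * x)\<^sup>2 - m\<^sup>2 * r\<^sup>2 \<ge> 0"
    using power_mono[OF Yx, of 2] r m by (simp add: power_mult_distrib)
  have "D * ((norm (q * (1 + w) + 1 - (m - 1) * w))\<^sup>2 - (norm (w * (q * (1 + w) + m - 1 - w)))\<^sup>2) > 0"
    unfolding D_def norm_square_gap
    unfolding D_def[symmetric] r_def[symmetric] x_def[symmetric] Y_def[symmetric]
    using \<open>r\<^sup>2 < 1\<close> D L M q by (intro add_pos_nonneg add_nonneg_pos mult_nonneg_nonneg mult_pos_pos add_nonneg_nonneg) auto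
  then show ?thesis
    using D by (simp add: zero_less_mult_iff power_less_imp_less_base)
qed

text \<open>The number \<open>n - 1 - sqrt (n\<^sup>2 - 2 n)\<close> is the smaller root of \<open>r\<^sup>2 - 2 (n - 1) r + 1\<close>; for
  \<open>n = 1\<close> and \<open>n = 2\<close> this polynomial is \<open>r\<^sup>2 + 1\<close> and \<open>(r - 1)\<^sup>2\<close>.\<close>

lemma root_bound:
  fixes r :: real and n :: nat
  assumes "r \<ge> 0"
    and "((n = 1 \<or> n = 2) \<and> r \<le> 1) \<or> (n \<ge> 3 \<and> r \<le> real n - 1 - sqrt ((real n)\<^sup>2 - 2 * real n))"
  shows "2 * (real n - 1) * r \<le> 1 + r\<^sup>2"
  using assms(2)
proof
  assume "(n = 1 \<or> n = 2) \<and> r \<le> 1"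
  then show ?thesis using zero_le_power2[of "r - 1"] by (auto simp: power2_eq_square algebra_simps)
next
  assume n: "n \<ge> 3 \<and> r \<le> real n - 1 - sqrt ((real n)\<^sup>2 - 2 * real n)"
  then have nn: "(real n)\<^sup>2 - 2 * real n \<ge> 0" by (simp add: power2_eq_square)
  have "sqrt ((real n)\<^sup>2 - 2 * real n) \<le> real n - 1 - r" using n by simp
  then have "(real n)\<^sup>2 - 2 * real n \<le> (real n - 1 - r)\<^sup>2"
    using power_mono[of "sqrt ((real n)\<^sup>2 - 2 * real n)" _ 2] nn by simp
  then show ?thesis by (simp add: power2_eq_square algebra_simps)
qed

section \<open>Hadamard products as differential operators\<close>

text \<open>Taylor coefficients \<open>\<alpha> + \<beta> n\<close> act on a power series as the operator \<open>\<alpha> + \<beta> z d/dz\<close>. The kernel \<open>k\<close> has the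
  constant term \<open>0\<close> instead of \<open>\<alpha>\<close>; this changes nothing because \<open>f 0 = 0\<close>.\<close>

lemma convolution_eqI:
  assumes f: "f holomorphic_on \<DD>"
    and e: "e has_fps_expansion Abs_fps (\<lambda>n. \<alpha> + \<beta> * of_nat n)"
    and k: "\<And>z. z \<in> \<DD> \<Longrightarrow> k z = e z - \<alpha>"
    and f0: "f 0 = 0" and z: "z \<in> \<DD>"
  shows "convolution k f z = \<alpha> * f z + \<beta> * (z * deriv f z)"
proof -
  define B where "B = fps_expansion f 0"
  have B: "f has_fps_expansion B"
    unfolding B_def using f by (intro has_fps_expansion_fps_expansion[of \<DD>]) auto
  have B0: "fps_nth B 0 = 0" using f0 by (simp add: B_def fps_expansion_def)
  have s1: "(\<lambda>n. fps_nth B n * z ^ n) sums f z"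
    by (rule has_fps_expansion_imp_sums_complex[OF B, of 1]) (use f z in \<open>auto simp: one_ereal_def\<close>)
  have "deriv f holomorphic_on \<DD>" using f by (intro holomorphic_deriv) auto
  then have s2: "(\<lambda>n. fps_nth (fps_X * fps_deriv B) n * z ^ n) sums (z * deriv f z)"
    by (intro has_fps_expansion_imp_sums_complex[of _ _ 1] has_fps_expansion_mult
        has_fps_expansion_fps_X has_fps_expansion_deriv B)
      (use z in \<open>auto intro!: holomorphic_intros simp: one_ereal_def\<close>)
  have X: "fps_nth (fps_X * fps_deriv B) n = of_nat n * fps_nth B n" for n
    by (cases n) auto
  have "(\<lambda>z. e z - \<alpha>) has_fps_expansion Abs_fps (\<lambda>n. \<alpha> + \<beta> * of_nat n) - fps_const \<alpha>"
    by (intro has_fps_expansion_diff e has_fps_expansion_const)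
  moreover have ev: "eventually (\<lambda>z. k z = e z - \<alpha>) (nhds 0)"
    using k by (intro eventually_nhds_in_open[of \<DD>, THEN eventually_mono]) auto
  ultimately have "k has_fps_expansion Abs_fps (\<lambda>n. \<alpha> + \<beta> * of_nat n) - fps_const \<alpha>"
    by (simp only: has_fps_expansion_cong[OF ev refl])
  then have "fps_expansion k 0 = Abs_fps (\<lambda>n. \<alpha> + \<beta> * of_nat n) - fps_const \<alpha>"
    by (rule fps_expansion_eqI)
  then have "fps_nth (fps_expansion k 0) n * fps_nth B n * z ^ n =
      \<alpha> * (fps_nth B n * z ^ n) + \<beta> * (fps_nth (fps_X * fps_deriv B) n * z ^ n)" for n
    unfolding X by (cases n) (simp_all add: B0 distrib_left distrib_right mult_ac)
  then show ?thesis
    unfolding convolution_def B_def[symmetric]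
    using sums_add[OF sums_mult[OF s1, of \<alpha>] sums_mult[OF s2, of \<beta>]]
    by (simp add: sums_iff)
qed

lemma half_plane_koebe_expansion:
  fixes \<alpha> \<beta> :: complex
  shows "(\<lambda>z. \<alpha> / (1 - z) + \<beta> * (z / (1 - z)\<^sup>2)) has_fps_expansion Abs_fps (\<lambda>n. \<alpha> + \<beta> * of_nat n)"
proof -
  define G where "G = (Abs_fps (\<lambda>n. 1) :: complex fps)"
  have "inverse (1 - fps_X) = G"
    unfolding G_def fps_inverse_gp'[symmetric] by (rule fps_inverse_idempotent) simp
  then have "(\<lambda>z. inverse (1 - z)) has_fps_expansion G"
    using has_fps_expansion_inverse[of "\<lambda>z. 1 - z" "1 - fps_X :: complex fps"]
    by (auto intro!: fps_expansion_intros)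
  then have "(\<lambda>z. \<alpha> * inverse (1 - z) + \<beta> * (z * (inverse (1 - z) * inverse (1 - z))))
      has_fps_expansion fps_const \<alpha> * G + fps_const \<beta> * (fps_X * (G * G))"
    by (intro fps_expansion_intros)
  moreover have "fps_const \<alpha> * G + fps_const \<beta> * (fps_X * (G * G)) = Abs_fps (\<lambda>n. \<alpha> + \<beta> * of_nat n)"
    by (rule fps_ext) (auto simp: G_def fps_mult_nth[of "Abs_fps (\<lambda>n. 1)"] split: nat.splits)
  ultimately show ?thesis by (simp add: field_simps power2_eq_square)
qed

section \<open>The convolution theorem\<close>

text \<open>The Jacobian equals \<open>norm (h')\<^sup>2 - norm (g')\<^sup>2\<close>. Nonvanishing of \<open>h'\<close> makes the dilatation a genuine
  quotient, not a division by zero.\<close>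

lemma jacobian_pos_imp_deriv_nonzero:
  assumes "h field_differentiable at z" "g field_differentiable at z"
    and "jacobian (harmonic_fun h g) z > 0"
  shows "deriv h z \<noteq> 0"
proof
  assume 0: "deriv h z = 0"
  have "(h has_derivative (\<lambda>v. deriv h z * v)) (at z)" "(g has_derivative (\<lambda>v. deriv g z * v)) (at z)"
    using assms by (auto simp: field_differentiable_derivI has_field_derivative_imp_has_derivative)
  then have "(harmonic_fun h g has_derivative (\<lambda>v. deriv h z * v + cnj (deriv g z * v))) (at z)"
    unfolding harmonic_fun_def
    by (intro has_derivative_add bounded_linear.has_derivative[OF bounded_linear_cnj])
  then have "frechet_derivative (harmonic_fun h g) (at z) = (\<lambda>v. deriv h z * v + cnj (deriv g z * v))"
    by (rule frechet_derivative_at[symmetric])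
  then show False
    using assms(3) 0 by (simp add: jacobian_def) (smt (verit) zero_le_square)
qed

theorem theorem4p6:
  fixes \<mu>1 \<mu>2 \<nu> :: real
    and h1 g1 h2 g2 :: "complex \<Rightarrow> complex"
    and a :: complex and n :: nat
  assumes h1: "\<And>z. z \<in> \<DD> \<Longrightarrow> h1 z = 1 / 2 * (z / (1 - z) + z / (1 - z)\<^sup>2)"
    and g1: "\<And>z. z \<in> \<DD> \<Longrightarrow>
        g1 z = exp (2 * \<i> * of_real \<mu>1) / 2 * (z / (1 - z) - z / (1 - z)\<^sup>2)"
    and f2: "normalized_harmonic h2 g2"
    and f2_locally_univalent: "locally_univalent_on (harmonic_fun h2 g2) \<DD>"
    and f2_sense_preserving: "sense_preserving_on (harmonic_fun h2 g2) \<DD>"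
    and f2_shear: "\<And>z. z \<in> \<DD> \<Longrightarrow>
        h2 z + exp (- 2 * \<i> * of_real \<mu>2) * g2 z =
        contour_integral (linepath 0 z)
          (\<lambda>\<xi>. 1 / (1 - 2 * \<xi> * exp (\<i> * of_real (\<mu>1 + \<mu>2)) * of_real (cos \<nu>)
                    + \<xi>\<^sup>2 * exp (2 * \<i> * of_real (\<mu>1 + \<mu>2))))"
    and a: "norm a \<le> 1"
    and n: "n \<ge> 1"
    and f2_dilatation: "\<And>z. z \<in> \<DD> \<Longrightarrow> dilatation h2 g2 z = a * z ^ n"
    and cases: "((n = 1 \<or> n = 2) \<and> norm a \<le> 1) \<or>
        (n \<ge> 3 \<and> norm a \<le> real n - 1 - sqrt ((real n)\<^sup>2 - 2 * real n))"
  shows "inj_on (harmonic_convolution h1 g1 h2 g2) \<DD>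
    \<and> maps_disc_convex_in_direction (- (\<mu>1 + \<mu>2)) (harmonic_convolution h1 g1 h2 g2)"
proof -
  define \<alpha> where "\<alpha> = \<mu>1 + \<mu>2"
  define k where "k = cis (- (2 * \<mu>2))"
  define e where "e = cis (2 * \<mu>1)"
  define K where "K = complex_of_real (cos \<nu>)"
  define P where "P = (\<lambda>z. 1 / (1 - 2 * K * (cis \<alpha> * z) + (cis \<alpha> * z)\<^sup>2))"
  define w where "w = (\<lambda>z. k * a * z ^ n)"
  define q where "q = (\<lambda>z. (1 - (cis \<alpha> * z)\<^sup>2) * P z)"
  define H where "H = (\<lambda>z. 1/2 * h2 z + 1/2 * (z * deriv h2 z))"
  define G where "G = (\<lambda>z. e/2 * g2 z + (- e/2) * (z * deriv g2 z))"
  have hol: "h2 holomorphic_on \<DD>" "g2 holomorphic_on \<DD>"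
    and zero: "h2 0 = 0" "g2 0 = 0"
    using f2 by (auto simp: normalized_harmonic_def)
  have expk: "exp (- 2 * \<i> * of_real \<mu>2) = k" and expe: "exp (2 * \<i> * of_real \<mu>1) = e"
    by (simp_all add: k_def e_def cis_conv_exp mult_ac)

  have conv_h: "convolution h1 h2 z = H z" if "z \<in> \<DD>" for z
    unfolding H_def
  proof (rule convolution_eqI[OF hol(1) half_plane_koebe_expansion _ zero(1) that])
    fix z :: complex assume "z \<in> \<DD>"
    then have "z \<noteq> 1" by auto
    then show "h1 z = 1/2 / (1 - z) + 1/2 * (z / (1 - z)\<^sup>2) - 1/2"
      unfolding h1[OF \<open>z \<in> \<DD>\<close>] by (simp add: divide_simps) (simp add: algebra_simps power2_eq_square)
  qed
  have conv_g: "convolution g1 g2 z = G z" if "z \<in> \<DD>" for z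
    unfolding G_def
  proof (rule convolution_eqI[OF hol(2) half_plane_koebe_expansion _ zero(2) that])
    fix z :: complex assume "z \<in> \<DD>"
    then have "z \<noteq> 1" by auto
    then show "g1 z = e/2 / (1 - z) + (- e/2) * (z / (1 - z)\<^sup>2) - e/2"
      unfolding g1[OF \<open>z \<in> \<DD>\<close>] expe
      by (simp add: divide_simps) (simp add: algebra_simps power2_eq_square)
  qed

  have nu: "norm (cis \<alpha> * z) < 1" if "z \<in> \<DD>" for z using that by (simp add: norm_mult)
  have den: "1 - 2 * K * (cis \<alpha> * z) + (cis \<alpha> * z)\<^sup>2 \<noteq> 0" if "z \<in> \<DD>" for z
    unfolding K_def by (rule quadratic_nonzero[OF nu[OF that]])
  have P0: "P z \<noteq> 0" if "z \<in> \<DD>" for z using den[OF that] by (simp add: P_def)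
  have q_pos: "Re (q z) > 0" if "z \<in> \<DD>" for z
    using Re_quotient_pos[OF nu[OF that], of \<nu>] by (simp add: q_def P_def K_def)
  have dP: "(P has_field_derivative
      (2 * K * cis \<alpha> - 2 * (cis \<alpha> * z) * cis \<alpha>) * (P z)\<^sup>2) (at z)" if "z \<in> \<DD>" for z
    unfolding P_def using den[OF that]
    by (auto intro!: derivative_eq_intros simp: power2_eq_square)
  have zP': "z * ((2 * K * cis \<alpha> - 2 * (cis \<alpha> * z) * cis \<alpha>) * (P z)\<^sup>2) = (q z - 1) * P z"
    if "z \<in> \<DD>" for z
  proof -
    have "P z * (1 - 2 * K * (cis \<alpha> * z) + (cis \<alpha> * z)\<^sup>2) = 1" using den[OF that] by (simp add: P_def)
    then show ?thesis unfolding q_def by algebra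
  qed
  have norm_w: "norm (w z) \<le> norm a" "norm (w z) < 1" if "z \<in> \<DD>" for z
  proof -
    have z: "norm z ^ n < 1" using that n by (simp add: power_less_one_iff)
    then show "norm (w z) \<le> norm a"
      by (simp add: w_def k_def norm_mult norm_power mult_left_le)
    show "norm (w z) < 1"
    proof (cases "a = 0")
      case False
      have "norm (w z) < norm a" using z False by (simp add: w_def k_def norm_mult norm_power)
      then show ?thesis using a by simp
    qed (simp add: w_def)
  qed
  have w1: "1 + w z \<noteq> 0" if "z \<in> \<DD>" for z
    using norm_w(2)[OF that] by (metis add_eq_0_iff2 norm_minus_cancel norm_one less_irrefl)

  \<comment> \<open>Differentiation of the integral representation.\<close>
  have shear': "deriv h2 z + k * deriv g2 z = P z" if z: "z \<in> \<DD>" for z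
  proof -
    have "P holomorphic_on \<DD>"
      using dP by (meson field_differentiable_def field_differentiable_at_within holomorphic_on_def)
    then obtain \<Psi> where \<Psi>: "\<And>x. x \<in> \<DD> \<Longrightarrow> (\<Psi> has_field_derivative P x) (at x within \<DD>)"
      using holomorphic_convex_primitive'[of \<DD> P] by auto
    have integrand: "(\<lambda>\<xi>. 1 / (1 - 2 * \<xi> * exp (\<i> * of_real (\<mu>1 + \<mu>2)) * of_real (cos \<nu>)
                    + \<xi>\<^sup>2 * exp (2 * \<i> * of_real (\<mu>1 + \<mu>2)))) = P"
    proof -
      have "exp (2 * \<i> * of_real (\<mu>1 + \<mu>2)) = (cis \<alpha>)\<^sup>2"
        by (simp add: \<alpha>_def cis_conv_exp power2_eq_square mult.assoc flip: exp_add)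
      then show ?thesis
        by (simp add: P_def K_def \<alpha>_def cis_conv_exp power_mult_distrib fun_eq_iff mult_ac)
    qed
    have eq: "h2 x + k * g2 x = \<Psi> x - \<Psi> 0" if "x \<in> \<DD>" for x
    proof -
      have "closed_segment 0 x \<subseteq> \<DD>" using that by (intro closed_segment_subset) auto
      then have "(P has_contour_integral \<Psi> x - \<Psi> 0) (linepath 0 x)"
        using contour_integral_primitive[of \<DD> \<Psi> P "linepath 0 x"] \<Psi> by auto
      then show ?thesis
        using f2_shear[OF that] unfolding integrand expk by (simp add: contour_integral_unique)
    qed
    have "((\<lambda>x. h2 x + k * g2 x) has_field_derivative deriv h2 z + k * deriv g2 z) (at z)"
      by (intro DERIV_add DERIV_cmult holomorphic_derivI[OF hol(1) _ z] holomorphic_derivI[OF hol(2) _ z]) auto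
    moreover have "((\<lambda>x. \<Psi> x - \<Psi> 0) has_field_derivative P z) (at z)"
      using \<Psi>[OF z] z by (auto intro!: derivative_eq_intros simp: at_within_open[of z \<DD>])
    then have "((\<lambda>x. h2 x + k * g2 x) has_field_derivative P z) (at z)"
      by (rule has_field_derivative_transform_within_open[where S = \<DD>]) (use z eq in auto)
    ultimately show ?thesis by (rule DERIV_unique)
  qed
  have h2'_nz: "deriv h2 z \<noteq> 0" if "z \<in> \<DD>" for z
    using hol that f2_sense_preserving
    by (intro jacobian_pos_imp_deriv_nonzero[of _ _ g2])
      (auto simp: sense_preserving_on_def intro!: holomorphic_on_imp_differentiable_at[of _ \<DD>])
  have g2': "deriv g2 z = a * z ^ n * deriv h2 z" if "z \<in> \<DD>" for z
    using f2_dilatation[OF that] h2'_nz[OF that] by (simp add: dilatation_def divide_eq_eq)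
  have h2': "deriv h2 z = P z / (1 + w z)" if "z \<in> \<DD>" for z
  proof -
    have "deriv h2 z * (1 + w z) = P z"
      using shear'[OF that] g2'[OF that] by (simp add: w_def algebra_simps)
    then show ?thesis using w1[OF that] by (simp add: field_simps)
  qed
  \<comment> \<open>\<open>A z\<close> is the common factor of \<open>H'\<close> and \<open>G'\<close>; dividing by it leaves the two expressions compared
      in \<open>dilatation_bound\<close>.\<close>
  define A where "A = (\<lambda>z. P z / (1 + w z)\<^sup>2)"
  define h2'' where "h2'' = (\<lambda>z. deriv (deriv h2) z)"
  define g2'' where "g2'' = (\<lambda>z. deriv (deriv g2) z)"
  have dd: "(deriv h2 has_field_derivative h2'' z) (at z)" "(deriv g2 has_field_derivative g2'' z) (at z)"
    if "z \<in> \<DD>" for z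
    unfolding h2''_def g2''_def using that hol
    by (auto intro!: holomorphic_derivI[where S = \<DD>] holomorphic_deriv)
  have z_pow: "z * (of_nat n * z ^ (n - 1)) = of_nat n * z ^ n" for z :: complex
    using n by (cases n) auto
  have zh2'': "z * h2'' z = A z * ((q z - 1) * (1 + w z) - of_nat n * w z)" if z: "z \<in> \<DD>" for z
  proof -
    let ?P' = "(2 * K * cis \<alpha> - 2 * (cis \<alpha> * z) * cis \<alpha>) * (P z)\<^sup>2"
    let ?w' = "k * a * (of_nat n * z ^ (n - 1))"
    have "((\<lambda>z. P z / (1 + w z)) has_field_derivative
        (?P' * (1 + w z) - P z * ?w') / ((1 + w z) * (1 + w z))) (at z)"
      unfolding w_def using w1[OF z]
      by (intro DERIV_divide dP z) (auto intro!: derivative_eq_intros simp: w_def)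
    then have "(deriv h2 has_field_derivative
        (?P' * (1 + w z) - P z * ?w') / ((1 + w z) * (1 + w z))) (at z)"
      by (rule has_field_derivative_transform_within_open[where S = \<DD>]) (use z h2' in auto)
    then have "h2'' z = (?P' * (1 + w z) - P z * ?w') / (1 + w z)\<^sup>2"
      using dd(1)[OF z] DERIV_unique by (metis power2_eq_square)
    then have "z * h2'' z = ((z * ?P') * (1 + w z) - P z * (k * a * (z * (of_nat n * z ^ (n - 1))))) / (1 + w z)\<^sup>2"
      by (simp add: algebra_simps)
    moreover have "(z * ?P') * (1 + w z) - P z * (k * a * (z * (of_nat n * z ^ (n - 1)))) =
        P z * ((q z - 1) * (1 + w z) - of_nat n * w z)"
      unfolding zP'[OF z] z_pow by (simp add: w_def algebra_simps)
    ultimately show ?thesis by (simp add: A_def)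
  qed
  have zg2'': "z * g2'' z = a * z ^ n * (of_nat n * deriv h2 z + z * h2'' z)" if z: "z \<in> \<DD>" for z
  proof -
    have "((\<lambda>z. a * z ^ n * deriv h2 z) has_field_derivative
        a * z ^ n * h2'' z + a * (of_nat n * z ^ (n - 1)) * deriv h2 z) (at z)"
      by (rule DERIV_mult'[OF _ dd(1)[OF z]]) (auto intro!: derivative_eq_intros)
    then have "(deriv g2 has_field_derivative
        a * z ^ n * h2'' z + a * (of_nat n * z ^ (n - 1)) * deriv h2 z) (at z)"
      by (rule has_field_derivative_transform_within_open[where S = \<DD>]) (use z g2' in auto)
    then have "g2'' z = a * z ^ n * h2'' z + a * (of_nat n * z ^ (n - 1)) * deriv h2 z"
      using dd(2)[OF z] DERIV_unique by blast
    then have "z * g2'' z = a * z ^ n * (z * h2'' z) + a * (z * (of_nat n * z ^ (n - 1))) * deriv h2 z"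
      by (simp add: algebra_simps)
    then show ?thesis unfolding z_pow by (simp add: algebra_simps)
  qed
  have h2'A: "deriv h2 z = A z * (1 + w z)" if "z \<in> \<DD>" for z
    using h2'[OF that] w1[OF that] by (simp add: A_def power2_eq_square)
  define H' where "H' = (\<lambda>z. 1/2 * A z * (q z * (1 + w z) + 1 - (real n - 1) * w z))"
  define G' where "G' = (\<lambda>z. - 1/2 * cis (2 * \<alpha>) * A z * (w z * (q z * (1 + w z) + real n - 1 - w z)))"
  have dH: "(H has_field_derivative H' z) (at z)" if z: "z \<in> \<DD>" for z
  proof -
    have "(H has_field_derivative 1/2 * deriv h2 z + 1/2 * (z * h2'' z + deriv h2 z)) (at z)"
      unfolding H_def using DERIV_mult'[OF DERIV_ident dd(1)[OF z]]
      by (intro DERIV_add DERIV_cmult holomorphic_derivI[OF hol(1) open_ball z]) simp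
    moreover have "1/2 * deriv h2 z + 1/2 * (z * h2'' z + deriv h2 z) = H' z"
      unfolding zh2''[OF z] h2'A[OF z] H'_def by (simp add: field_simps)
    ultimately show ?thesis by simp
  qed
  have dG: "(G has_field_derivative G' z) (at z)" if z: "z \<in> \<DD>" for z
  proof -
    have ek: "e = cis (2 * \<alpha>) * k" by (simp add: e_def k_def \<alpha>_def cis_mult algebra_simps)
    have "(G has_field_derivative e/2 * deriv g2 z + (- e/2) * (z * g2'' z + deriv g2 z)) (at z)"
      unfolding G_def using DERIV_mult'[OF DERIV_ident dd(2)[OF z]]
      by (intro DERIV_add DERIV_cmult holomorphic_derivI[OF hol(2) open_ball z]) simp
    moreover have "e/2 * deriv g2 z + (- e/2) * (z * g2'' z + deriv g2 z) = - 1/2 * cis (2 * \<alpha>) * (k * (z * g2'' z))"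
      unfolding ek by (simp add: algebra_simps)
    moreover have "k * (z * g2'' z) = A z * (w z * (q z * (1 + w z) + real n - 1 - w z))"
    proof -
      have "k * (z * g2'' z) = w z * (of_nat n * (A z * (1 + w z)) + A z * ((q z - 1) * (1 + w z) - of_nat n * w z))"
        unfolding zg2''[OF z] zh2''[OF z] h2'A[OF z] by (simp add: w_def algebra_simps)
      then show ?thesis by (simp add: algebra_simps)
    qed
    ultimately show ?thesis by (simp add: G'_def mult.assoc)
  qed
  have A0: "A z \<noteq> 0" if "z \<in> \<DD>" for z using P0[OF that] w1[OF that] by (simp add: A_def)
  have "inj_on (harmonic_fun H G) \<DD> \<and> maps_disc_convex_in_direction (- \<alpha>) (harmonic_fun H G)"
  proof (rule royster_ziegler_harmonic[where \<epsilon> = "1/2" and \<nu> = \<nu>, OF dH dG])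
    fix z assume z: "z \<in> \<DD>"
    have "2 * (real n - 1) * norm (w z) \<le> 1 + (norm (w z))\<^sup>2"
      using cases norm_w(1)[OF z] by (intro root_bound) auto
    then have "norm (w z * (q z * (1 + w z) + real n - 1 - w z))
        < norm (q z * (1 + w z) + 1 - (real n - 1) * w z)"
      using dilatation_bound[OF q_pos[OF z] norm_w(2)[OF z], of "real n"] n by simp
    then show "norm (G' z) < norm (H' z)"
      unfolding G'_def H'_def norm_mult using A0[OF z] by simp
  next
    fix z assume z: "z \<in> \<DD>"
    have cc: "cis (- (2 * \<alpha>)) * (cis (2 * \<alpha>) * x) = x" for x
      by (simp add: cis_mult flip: mult.assoc)
    have cG: "cis (- (2 * \<alpha>)) * G' z =
        - 1/2 * A z * (w z * (q z * (1 + w z) + real n - 1 - w z))"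
      using cc[of "A z * (w z * (q z * (1 + w z) + real n - 1 - w z))"] by (simp add: G'_def mult_ac)
    have "H' z - cis (- (2 * \<alpha>)) * G' z = 1/2 * A z * (1 + w z) * (q z * (1 + w z) + (1 - w z))"
      unfolding cG H'_def by (simp add: field_simps)
    also have "\<dots> = 1/2 * P z * (q z + (1 - w z) / (1 + w z))"
    proof -
      have "1/2 * (P z / d\<^sup>2) * d * (q z * d + m) = 1/2 * P z * (q z + m / d)" if "d \<noteq> 0" for d m
        using that by (simp add: field_simps power2_eq_square)
      from this[OF w1[OF z]] show ?thesis unfolding A_def .
    qed
    finally have difference: "H' z - cis (- (2 * \<alpha>)) * G' z = 1/2 * P z * (q z + (1 - w z) / (1 + w z))" .
    have PQ: "1/2 * x * y * p = 1/2 * y" if "x * p = 1" for x y p :: complex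
      using that by algebra
    have "P z * (1 - 2 * K * (cis \<alpha> * z) + (cis \<alpha> * z)\<^sup>2) = 1"
      using den[OF z] by (simp add: P_def)
    then have product: "(H' z - cis (- (2 * \<alpha>)) * G' z) * (1 - 2 * K * (cis \<alpha> * z) + (cis \<alpha> * z)\<^sup>2) =
        1/2 * (q z + (1 - w z) / (1 + w z))"
      unfolding difference by (rule PQ)
    have "Re ((1 - w z) / (1 + w z)) \<ge> 0"
    proof -
      have "Re ((1 - w z) / (1 + w z)) = (1 - (norm (w z))\<^sup>2) / (norm (1 + w z))\<^sup>2"
        unfolding Re_divide cmod_power2 by (simp add: power2_eq_square algebra_simps)
      then show ?thesis using norm_w(2)[OF z] by (simp add: power_le_one)
    qed
    moreover have q_eq: "(1 - (cis \<alpha> * z)\<^sup>2) / (1 - 2 * K * (cis \<alpha> * z) + (cis \<alpha> * z)\<^sup>2) = q z"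
      by (simp add: q_def P_def)
    ultimately show "1/2 * Re ((1 - (cis \<alpha> * z)\<^sup>2) /
          (1 - 2 * of_real (cos \<nu>) * (cis \<alpha> * z) + (cis \<alpha> * z)\<^sup>2))
        \<le> Re ((H' z - cis (- (2 * \<alpha>)) * G' z) *
          (1 - 2 * of_real (cos \<nu>) * (cis \<alpha> * z) + (cis \<alpha> * z)\<^sup>2))"
      unfolding K_def[symmetric] product q_eq by simp
  qed auto
  moreover have "harmonic_convolution h1 g1 h2 g2 z = harmonic_fun H G z" if "z \<in> \<DD>" for z
    using conv_h[OF that] conv_g[OF that] by (simp add: harmonic_convolution_def harmonic_fun_def)
  then have "inj_on (harmonic_convolution h1 g1 h2 g2) \<DD> = inj_on (harmonic_fun H G) \<DD>"
    and "harmonic_convolution h1 g1 h2 g2 ` \<DD> = harmonic_fun H G ` \<DD>"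
    by (auto intro!: inj_on_cong image_cong)
  ultimately show ?thesis
    by (simp add: maps_disc_convex_in_direction_def \<alpha>_def)
qed

end
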